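(* Let $\tau\in\mathfrak M_{1,c}(\mathcal P)$. Suppose that $J_{\ker}(G_\tau)=\emptyset$ and $\hat K(G_\tau)\ne\emptyset$. Then all of the following hold. 1. $\operatorname{int}(\hat K(G_\tau))\ne\emptyset$. 2. $T_{\infty,\tau}(J(G_\tau))=[0,1]$. 3. For each $t_1,t_2$ with $0\le t_1<t_2\le1$, $T_{\infty,\tau}^{-1}(\{t_1\})<_sT_{\infty,\tau}^{-1}(\{t_2\})\cap J(G_\tau)$. 4. For each $t\in(0,1)$, $\hat K(G_\tau)<_sT_{\infty,\tau}^{-1}(\{t\})\cap J(G_\tau)<_s\overline{F_\infty(G_\tau)}$. 5. There exists an uncountable dense subset $A$ of $[0,1]$ with $\sharp([0,1]\setminus A)\le\aleph_0$ such that for each $t\in A$, $\emptyset\ne T_{\infty,\tau}^{-1}(\{t\})\cap J(G_\tau)\subset J_{res}(G_\tau)$.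
   Context: $\hat{\mathbb C}$ is the Riemann sphere with spherical distance $d$. $\mathcal P$ is the set of polynomial maps $\hat{\mathbb C}\to\hat{\mathbb C}$ of degree at least $2$, with the metric $\kappa(f,g)=\sup_zd(f(z),g(z))$. $\mathfrak M_{1,c}(\mathcal P)$ is the set of Borel probability measures on $\mathcal P$ with compact topological support. For a semigroup $G$ of polynomials, $F(G)$ is the set of $z\in\hat{\mathbb C}$ having a neighborhood on which $G$ is equicontinuous with respect to $d$; $J(G)=\hat{\mathbb C}\setminus F(G)$; $J_{\ker}(G)=\bigcap_{g\in G}g^{-1}(J(G))$; $\hat K(G)=\{z\in\mathbb C:\{g(z):g\in G\}\text{ is bounded in }\mathbb C\}$; $F_\infty(G)$ is the connected component of $F(G)$ containing $\infty$ (one has $\infty\in F(G)$ when $G$ is generated by a compact subset of $\mathcal P$); $J_{res}(G)$ is the set of $z\in J(G)$ such that $z\notin\partial U$ for every connected component $U$ of $F(G)$. $G_\tau$ is the semigroup generated under composition by $\operatorname{supp}\tau$, and $\tilde\tau=\otimes_{j=1}^\infty\tau$. $T_{\infty,\tau}(z)=\tilde\tau(\{\gamma=(\gamma_1,\gamma_2,\dots):\ \gamma_n\circ\cdots\circ\gamma_1(z)\to\infty\text{ as }n\to\infty\})$. For non-empty compact $K_1,K_2\subset\hat{\mathbb C}$, $K_1<_sK_2$ means that $K_1$ is included in the union of all bounded connected components of $\mathbb C\setminus K_2$. *)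

theory Defs
  imports "HOL-Probability.Probability"
begin

section \<open>The Riemann sphere with the spherical distance\<close>

datatype riemann_sphere = Fin complex | Infty

text \<open>Inverse stereographic projection onto the Euclidean unit sphere of
  \<open>complex \<times> real\<close>.\<close>

fun sphere_pt :: "riemann_sphere \<Rightarrow> complex \<times> real" where
  "sphere_pt (Fin z) =
     ((2 / ((norm z)\<^sup>2 + 1)) *\<^sub>R z, ((norm z)\<^sup>2 - 1) / ((norm z)\<^sup>2 + 1))"
| "sphere_pt Infty = (0, 1)"

lemma norm_sphere_pt [simp]: "norm (sphere_pt x) = 1"
proof (cases x)
  case (Fin z)
  have pos: "(norm z)\<^sup>2 + 1 > 0" by (simp add: add_nonneg_pos)
  have "(2 * norm z / ((norm z)\<^sup>2 + 1))\<^sup>2 + (((norm z)\<^sup>2 - 1) / ((norm z)\<^sup>2 + 1))\<^sup>2 = 1"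
    using pos by (simp add: divide_simps) (simp add: power2_eq_square algebra_simps)
  then show ?thesis using pos Fin by (simp add: norm_Pair power_divide)
qed (simp add: norm_Pair)

lemma inj_sphere_pt: "inj sphere_pt"
proof (rule injI)
  fix x y assume eq: "sphere_pt x = sphere_pt y"
  have snd_Fin: "snd (sphere_pt (Fin z)) = 1 - 2 / ((norm z)\<^sup>2 + 1)" for z
  proof -
    have "(norm z)\<^sup>2 + 1 > 0" by (simp add: add_nonneg_pos)
    then show ?thesis by (simp add: field_simps)
  qed
  have pos: "2 / ((norm z)\<^sup>2 + 1) > 0" for z :: complex
    by (simp add: add_nonneg_pos)
  show "x = y"
  proof (cases x)
    case (Fin z)
    show ?thesis
    proof (cases y)
      case y: (Fin w)
      have 1: "2 / ((norm z)\<^sup>2 + 1) = 2 / ((norm w)\<^sup>2 + 1)"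
        using arg_cong[OF eq, of snd] unfolding Fin y snd_Fin by simp
      have "(2 / ((norm z)\<^sup>2 + 1)) *\<^sub>R z = (2 / ((norm w)\<^sup>2 + 1)) *\<^sub>R w"
        using arg_cong[OF eq, of fst] unfolding Fin y by simp
      then have "(2 / ((norm w)\<^sup>2 + 1)) *\<^sub>R z = (2 / ((norm w)\<^sup>2 + 1)) *\<^sub>R w"
        unfolding 1 .
      then have "z = w" using pos[of w] by simp
      then show ?thesis using Fin y by simp
    next
      case Infty
      then show ?thesis using arg_cong[OF eq, of snd] pos[of z] unfolding Fin snd_Fin by simp
    qed
  next
    case Infty
    then show ?thesis
    proof (cases y)
      case (Fin w)
      then show ?thesis using Infty arg_cong[OF eq, of snd] pos[of w] unfolding Fin snd_Fin by simp
    qed simp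
  qed
qed

lemma inner_sphere_pt_bounds: "sphere_pt x \<bullet> sphere_pt y \<ge> -1" "sphere_pt x \<bullet> sphere_pt y \<le> 1"
  using Cauchy_Schwarz_ineq2[of "sphere_pt x" "sphere_pt y"] by simp_all

text \<open>The triangle inequality for angles between unit vectors.\<close>

lemma arccos_inner_triangle:
  fixes u v w :: "'a::real_inner"
  assumes [simp]: "norm u = 1" "norm v = 1" "norm w = 1"
  shows "arccos (u \<bullet> w) \<le> arccos (u \<bullet> v) + arccos (v \<bullet> w)"
proof -
  have uu: "u \<bullet> u = 1" "v \<bullet> v = 1" "w \<bullet> w = 1"
    by (simp_all add: dot_square_norm)
  have b: "\<bar>u \<bullet> v\<bar> \<le> 1" "\<bar>v \<bullet> w\<bar> \<le> 1" "\<bar>u \<bullet> w\<bar> \<le> 1"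
    using Cauchy_Schwarz_ineq2[of u v] Cauchy_Schwarz_ineq2[of v w] Cauchy_Schwarz_ineq2[of u w]
    by simp_all
  define a where "a = arccos (u \<bullet> v)"
  define c where "c = arccos (v \<bullet> w)"
  have ac: "0 \<le> a" "a \<le> pi" "0 \<le> c" "c \<le> pi" "0 \<le> arccos (u \<bullet> w)" "arccos (u \<bullet> w) \<le> pi"
    using b unfolding a_def c_def by (auto intro!: arccos_lbound arccos_ubound)
  have cosac: "cos a = u \<bullet> v" "cos c = v \<bullet> w"
    using b unfolding a_def c_def by (auto intro!: cos_arccos)
  define p where "p = u - (u \<bullet> v) *\<^sub>R v"
  define q where "q = w - (v \<bullet> w) *\<^sub>R v"
  have "(norm p)\<^sup>2 = (sin a)\<^sup>2"
    unfolding p_def power2_norm_eq_inner sin_squared_eq cosac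
    by (simp add: inner_diff_left inner_diff_right uu inner_commute power2_eq_square)
  then have np: "norm p = sin a" using ac sin_ge_zero by (simp add: power2_eq_iff_nonneg)
  have "(norm q)\<^sup>2 = (sin c)\<^sup>2"
    unfolding q_def power2_norm_eq_inner sin_squared_eq cosac
    by (simp add: inner_diff_left inner_diff_right uu inner_commute power2_eq_square)
  then have nq: "norm q = sin c" using ac sin_ge_zero by (simp add: power2_eq_iff_nonneg)
  have "u \<bullet> w = cos a * cos c + p \<bullet> q"
    unfolding p_def q_def cosac
    by (simp add: inner_diff_left inner_diff_right uu inner_commute algebra_simps)
  moreover have "p \<bullet> q \<ge> - (sin a * sin c)"
    using Cauchy_Schwarz_ineq2[of p q] np nq by simp
  ultimately have le: "cos (a + c) \<le> u \<bullet> w" by (simp add: cos_add)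
  show ?thesis
  proof (cases "a + c \<le> pi")
    case True
    have "arccos (u \<bullet> w) \<le> arccos (cos (a + c))"
      using le b by (intro arccos_le_arccos) auto
    also have "\<dots> = a + c" using True ac by (intro arccos_cos) auto
    finally show ?thesis unfolding a_def c_def .
  next
    case False
    then show ?thesis using ac unfolding a_def c_def by linarith
  qed
qed

text \<open>The spherical distance is the length of the shortest great-circle arc on the unit sphere,
  i.e. the distance induced by the metric \<open>2 |dz| / (1 + |z|\<^sup>2)\<close>.\<close>

instantiation riemann_sphere :: metric_space
begin

definition dist_riemann_sphere :: "riemann_sphere \<Rightarrow> riemann_sphere \<Rightarrow> real" where
  "dist x y = arccos (sphere_pt x \<bullet> sphere_pt y)"

definition uniformity_riemann_sphere :: "(riemann_sphere \<times> riemann_sphere) filter" where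
  "uniformity = (INF e\<in>{0 <..}. principal {(x::riemann_sphere, y). dist x y < e})"

definition open_riemann_sphere where
  "open (U :: riemann_sphere set) = (\<forall>x\<in>U. eventually (\<lambda>(x', y). x' = x \<longrightarrow> y \<in> U) uniformity)"

instance
proof
  fix x y z :: riemann_sphere
  show "(dist x y = 0) = (x = y)"
  proof
    assume "dist x y = 0"
    then have "cos (arccos (sphere_pt x \<bullet> sphere_pt y)) = cos 0"
      unfolding dist_riemann_sphere_def by simp
    then have 1: "sphere_pt x \<bullet> sphere_pt y = 1"
      using inner_sphere_pt_bounds[of x y] by (simp add: cos_arccos)
    have "(sphere_pt x - sphere_pt y) \<bullet> (sphere_pt x - sphere_pt y)
        = sphere_pt x \<bullet> sphere_pt x + sphere_pt y \<bullet> sphere_pt y - 2 * (sphere_pt x \<bullet> sphere_pt y)"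
      by (simp only: inner_diff_left inner_diff_right inner_commute[of "sphere_pt y" "sphere_pt x"])
    then have "sphere_pt x = sphere_pt y"
      by (simp add: 1 dot_square_norm)
    then show "x = y" using inj_sphere_pt by (simp add: inj_eq)
  next
    assume "x = y"
    then show "dist x y = 0"
      unfolding dist_riemann_sphere_def by (simp add: dot_square_norm)
  qed
  show "dist x y \<le> dist x z + dist y z"
    unfolding dist_riemann_sphere_def
    using arccos_inner_triangle[of "sphere_pt x" "sphere_pt z" "sphere_pt y"]
    by (simp add: inner_commute)
qed (simp_all add: uniformity_riemann_sphere_def open_riemann_sphere_def)

end

lemma dist_riemann_sphere_le_pi: "dist x y \<le> pi" for x y :: riemann_sphere
  unfolding dist_riemann_sphere_def using inner_sphere_pt_bounds by (intro arccos_ubound)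


section \<open>Polynomial maps of degree at least two\<close>

fun poly_on_sphere :: "complex poly \<Rightarrow> riemann_sphere \<Rightarrow> riemann_sphere" where
  "poly_on_sphere p (Fin z) = Fin (poly p z)"
| "poly_on_sphere p Infty = Infty"

typedef polynomial_map = "{poly_on_sphere p | p. degree p \<ge> 2}"
  morphisms app_pm Abs_polynomial_map
proof
  show "poly_on_sphere (monom 1 2) \<in> {poly_on_sphere p | p. degree p \<ge> 2}"
    by (auto simp: degree_monom_eq intro!: exI[of _ "monom 1 2"])
qed

lemma bdd_above_dist_app_pm: "bdd_above (range (\<lambda>z. dist (app_pm f z) (app_pm g z)))"
  by (rule bdd_aboveI[of _ pi]) (auto simp: dist_riemann_sphere_le_pi)

text \<open>The metric is \<open>\<kappa>(f, g) = sup\<^sub>z d(f(z), g(z))\<close>.\<close>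

instantiation polynomial_map :: metric_space
begin

definition dist_polynomial_map :: "polynomial_map \<Rightarrow> polynomial_map \<Rightarrow> real" where
  "dist f g = (SUP z. dist (app_pm f z) (app_pm g z))"

definition uniformity_polynomial_map :: "(polynomial_map \<times> polynomial_map) filter" where
  "uniformity = (INF e\<in>{0 <..}. principal {(f::polynomial_map, g). dist f g < e})"

definition open_polynomial_map where
  "open (U :: polynomial_map set) = (\<forall>f\<in>U. eventually (\<lambda>(f', g). f' = f \<longrightarrow> g \<in> U) uniformity)"

instance
proof
  fix f g h :: polynomial_map
  have le: "dist (app_pm f z) (app_pm g z) \<le> dist f g" for f g z
    unfolding dist_polynomial_map_def by (rule cSUP_upper[OF UNIV_I bdd_above_dist_app_pm])
  show "(dist f g = 0) = (f = g)"
  proof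
    assume "dist f g = 0"
    then have "app_pm f z = app_pm g z" for z using le[of f z g] by simp
    then show "f = g" by (simp add: app_pm_inject[symmetric] fun_eq_iff)
  qed (simp add: dist_polynomial_map_def)
  show "dist f g \<le> dist f h + dist g h"
    unfolding dist_polynomial_map_def[of f g]
  proof (rule cSUP_least)
    fix z
    show "dist (app_pm f z) (app_pm g z) \<le> dist f h + dist g h"
      using dist_triangle2[of "app_pm f z" "app_pm g z" "app_pm h z"] le[of f z h] le[of g z h]
      by linarith
  qed simp
qed (simp_all add: uniformity_polynomial_map_def open_polynomial_map_def)

end


section \<open>Semigroups generated by polynomial maps\<close>

inductive_set generated_semigroup ::
    "(riemann_sphere \<Rightarrow> riemann_sphere) set \<Rightarrow> (riemann_sphere \<Rightarrow> riemann_sphere) set"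
  for S where
  generator: "g \<in> S \<Longrightarrow> g \<in> generated_semigroup S"
| compose: "g \<in> generated_semigroup S \<Longrightarrow> h \<in> generated_semigroup S
    \<Longrightarrow> g \<circ> h \<in> generated_semigroup S"

definition equicontinuous_on ::
    "'a::metric_space set \<Rightarrow> ('a \<Rightarrow> 'b::metric_space) set \<Rightarrow> bool" where
  "equicontinuous_on U G \<longleftrightarrow>
     (\<forall>x\<in>U. \<forall>e>0. \<exists>d>0. \<forall>y\<in>U. dist x y < d \<longrightarrow> (\<forall>g\<in>G. dist (g x) (g y) < e))"

definition fatou_set :: "(riemann_sphere \<Rightarrow> riemann_sphere) set \<Rightarrow> riemann_sphere set" where
  "fatou_set G = {z. \<exists>U. open U \<and> z \<in> U \<and> equicontinuous_on U G}"

definition julia_set :: "(riemann_sphere \<Rightarrow> riemann_sphere) set \<Rightarrow> riemann_sphere set" where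
  "julia_set G = - fatou_set G"

definition kernel_julia_set :: "(riemann_sphere \<Rightarrow> riemann_sphere) set \<Rightarrow> riemann_sphere set" where
  "kernel_julia_set G = (\<Inter>g\<in>G. g -` julia_set G)"

definition smallest_filled_julia_set :: "(riemann_sphere \<Rightarrow> riemann_sphere) set \<Rightarrow> complex set" where
  "smallest_filled_julia_set G = {z. \<exists>B. bounded B \<and> (\<forall>g\<in>G. g (Fin z) \<in> Fin ` B)}"

definition fatou_infinity :: "(riemann_sphere \<Rightarrow> riemann_sphere) set \<Rightarrow> riemann_sphere set" where
  "fatou_infinity G = connected_component_set (fatou_set G) Infty"

definition residual_julia_set :: "(riemann_sphere \<Rightarrow> riemann_sphere) set \<Rightarrow> riemann_sphere set" where
  "residual_julia_set G = {z \<in> julia_set G. \<forall>U\<in>components (fatou_set G). z \<notin> frontier U}"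


section \<open>Random dynamics\<close>

definition topological_support :: "'a::topological_space measure \<Rightarrow> 'a set" where
  "topological_support M = {x. \<forall>U. open U \<longrightarrow> x \<in> U \<longrightarrow> emeasure M U > 0}"

definition compactly_supported_prob_measures :: "'a::topological_space measure set" where
  "compactly_supported_prob_measures =
     {M. prob_space M \<and> sets M = sets borel \<and> compact (topological_support M)}"

definition semigroup_of :: "polynomial_map measure \<Rightarrow> (riemann_sphere \<Rightarrow> riemann_sphere) set" where
  "semigroup_of \<tau> = generated_semigroup (app_pm ` topological_support \<tau>)"

text \<open>Sequences are indexed from \<open>0\<close>: \<open>orbit \<gamma> z n\<close> applies \<open>\<gamma> 0\<close> first and \<open>\<gamma> (n - 1)\<close> last.\<close>

primrec orbit :: "(nat \<Rightarrow> polynomial_map) \<Rightarrow> riemann_sphere \<Rightarrow> nat \<Rightarrow> riemann_sphere" where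
  "orbit \<gamma> z 0 = z"
| "orbit \<gamma> z (Suc n) = app_pm (\<gamma> n) (orbit \<gamma> z n)"

definition prob_escape :: "polynomial_map measure \<Rightarrow> riemann_sphere \<Rightarrow> real" where
  "prob_escape \<tau> z = measure (PiM (UNIV :: nat set) (\<lambda>_. \<tau>)) {\<gamma>. orbit \<gamma> z \<longlonglongrightarrow> Infty}"


section \<open>The surrounding order\<close>

text \<open>The relation is only defined for non-empty compact sets, so asserting it includes these
  conditions.  The complement of \<open>K2\<close> is taken in the plane, and boundedness is Euclidean.\<close>

definition surrounded_by :: "riemann_sphere set \<Rightarrow> riemann_sphere set \<Rightarrow> bool"
    (infix \<open><\<^sub>s\<close> 50) where
  "K1 <\<^sub>s K2 \<longleftrightarrow> K1 \<noteq> {} \<and> compact K1 \<and> K2 \<noteq> {} \<and> compact K2 \<and>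
     K1 \<subseteq> Fin ` \<Union>{U \<in> components (UNIV - Fin -` K2). bounded U}"

end

theory Submission
  imports Defs "HOL-Complex_Analysis.Complex_Analysis"
begin

text \<open>Compactness of the support gives a radius beyond which every generator at least doubles the
  modulus. Hence whether a random orbit escapes is decided by its entering a fixed neighbourhood of
  infinity, and equicontinuity of the semigroup at a Fatou point makes the escape probability
  \<open>T\<close> locally constant there. Since \<open>T\<close> is harmonic, i.e. \<open>T z = \<integral> T (f z) d\<tau>(f)\<close>, the set of points
  where the oscillation of \<open>T\<close> is maximal is forward invariant; if that maximum were positive this
  set would be contained in the kernel Julia set, so \<open>T\<close> is continuous on the sphere. A connected
  set containing a Fatou point on a level of \<open>T\<close>, but no Julia point on that level, lies entirely in
  the level; with the intermediate value theorem this yields the claims on level sets. The residual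
  statement holds because \<open>T\<close> has only countably many values on the Fatou set.\<close>

section \<open>The topology of the Riemann sphere\<close>

text \<open>A priori \<open>T\<close> may jump on the Julia set. The kernel Julia set is an
  intersection over all words, while averaging over \<open>\<tau>\<close> only sees almost every
  map. The topological support bridges the two: every neighbourhood of an \<open>f\<close> in it has
  positive mass, so a definite loss of oscillation at \<open>f z\<close> is a definite loss at
  \<open>z\<close>. That loss has to be weighed against the contribution of all other maps at once,
  so oscillation is measured at a scale uniform over the whole sphere, and compactness of the
  support keeps the images of nearby points uniformly close. The other obstacle is the metric:
  closeness of maps is spherical and compresses neighbourhoods of infinity, so it does not compare
  moduli there directly. A common escape radius therefore needs an argument of its own. For the
  level sets, suppose a component of the complement of a Julia level were unbounded and contained a
  point of a lower level. Then \<open>T\<close> would take the higher value on it, necessarily at a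
  Fatou point, and would thus be constant on it.\<close>

lemma countable_dense_imp_countable_subbasis:
  fixes D :: "'a::metric_space set"
  assumes D: "countable D" and dense: "\<And>x e. e > 0 \<Longrightarrow> \<exists>d\<in>D. dist d x < e"
  shows "\<exists>B::'a set set. countable B \<and> open = generate_topology B"
proof -
  define B where "B = (\<lambda>(d, q). ball d q) ` (D \<times> \<rat>)"
  have "topological_basis B"
  proof (rule topological_basisI)
    fix S :: "'a set" and x assume "open S" "x \<in> S"
    then obtain e where e: "e > 0" "ball x e \<subseteq> S" using open_contains_ball by blast
    obtain q where q: "q \<in> \<rat>" "0 < q" "q < e / 2"
      using Rats_dense_in_real[of 0 "e / 2"] e by auto
    obtain d where d: "d \<in> D" "dist d x < q" using dense q by blast
    have "ball d q \<subseteq> ball x e"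
    proof
      fix y assume "y \<in> ball d q"
      then have "dist x y < q + q"
        using d dist_triangle[of x y d] by (simp add: dist_commute)
      then show "y \<in> ball x e" using q by simp
    qed
    then show "\<exists>B'\<in>B. x \<in> B' \<and> B' \<subseteq> S"
      using d q e by (intro bexI[of _ "ball d q"]) (auto simp: B_def)
  qed (auto simp: B_def)
  moreover have "countable B"
    unfolding B_def using D countable_rat by blast
  ultimately show ?thesis using topological_basis_imp_subbasis by blast
qed

section \<open>The chordal embedding as a model of the topology\<close>

lemma norm_sphere_pt_diff:
  "(norm (sphere_pt x - sphere_pt y))\<^sup>2 = 2 - 2 * cos (dist x y)"
proof -
  have "cos (dist x y) = sphere_pt x \<bullet> sphere_pt y"
    unfolding dist_riemann_sphere_def using inner_sphere_pt_bounds by (simp add: cos_arccos)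
  moreover have "(norm (sphere_pt x - sphere_pt y))\<^sup>2
      = sphere_pt x \<bullet> sphere_pt x + sphere_pt y \<bullet> sphere_pt y - 2 * (sphere_pt x \<bullet> sphere_pt y)"
    unfolding power2_norm_eq_inner
    by (simp only: inner_diff_left inner_diff_right inner_commute[of "sphere_pt y" "sphere_pt x"])
  ultimately show ?thesis by (simp add: dot_square_norm)
qed

lemma dist_sphere_pt:
  "dist x y = arccos (1 - (norm (sphere_pt x - sphere_pt y))\<^sup>2 / 2)" for x y :: riemann_sphere
proof -
  have "dist x y = arccos (cos (dist x y))"
    using dist_riemann_sphere_le_pi by (simp add: arccos_cos)
  then show ?thesis by (simp add: norm_sphere_pt_diff diff_divide_distrib)
qed

text \<open>Chord length and arc length determine each other through \<open>cos\<close> and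
  \<open>arccos\<close>, both continuous at the relevant endpoints. Hence \<open>sphere_pt\<close>
  is a topological embedding, and continuity questions on the sphere become questions about explicit
  formulas.\<close>

lemma tendsto_sphere_pt_iff:
  "(f \<longlongrightarrow> x) F \<longleftrightarrow> ((\<lambda>t. sphere_pt (f t)) \<longlongrightarrow> sphere_pt x) F"
proof
  assume "(f \<longlongrightarrow> x) F"
  then have "((\<lambda>t. dist (f t) x) \<longlongrightarrow> 0) F"
    by (rule tendsto_dist_iff[THEN iffD1])
  then have "((\<lambda>t. 2 - 2 * cos (dist (f t) x)) \<longlongrightarrow> 2 - 2 * cos 0) F"
    by (intro tendsto_diff tendsto_mult tendsto_const isCont_tendsto_compose[of 0 cos]) simp_all
  then have "((\<lambda>t. sqrt ((norm (sphere_pt (f t) - sphere_pt x))\<^sup>2)) \<longlongrightarrow> sqrt 0) F"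
    unfolding norm_sphere_pt_diff by (intro tendsto_intros) simp
  then show "((\<lambda>t. sphere_pt (f t)) \<longlongrightarrow> sphere_pt x) F"
    by (simp add: tendsto_dist_iff[of _ "sphere_pt x"] dist_norm)
next
  assume "((\<lambda>t. sphere_pt (f t)) \<longlongrightarrow> sphere_pt x) F"
  then have "((\<lambda>t. norm (sphere_pt (f t) - sphere_pt x)) \<longlongrightarrow> 0) F"
    by (simp add: tendsto_dist_iff[of _ "sphere_pt x"] dist_norm)
  then have "((\<lambda>t. 1 - (norm (sphere_pt (f t) - sphere_pt x))\<^sup>2 / 2) \<longlongrightarrow> 1 - 0\<^sup>2 / 2) F"
    by (intro tendsto_intros) auto
  moreover have "1 - (norm (sphere_pt (f t) - sphere_pt x))\<^sup>2 / 2 \<in> {-1..1}" for t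
    by (simp add: norm_sphere_pt_diff diff_divide_distrib)
  ultimately have "((\<lambda>t. arccos (1 - (norm (sphere_pt (f t) - sphere_pt x))\<^sup>2 / 2)) \<longlongrightarrow> arccos 1) F"
    by (intro continuous_on_tendsto_compose[OF continuous_on_arccos'] always_eventually) auto
  then show "(f \<longlongrightarrow> x) F"
    unfolding tendsto_dist_iff[of f x] dist_sphere_pt by simp
qed

lemma continuous_on_Fin [continuous_intros]:
  "continuous_on S f \<Longrightarrow> continuous_on S (\<lambda>x. Fin (f x))"
proof -
  assume f: "continuous_on S f"
  have "(norm z)\<^sup>2 + 1 \<noteq> 0" for z :: complex
    using add_nonneg_pos[of "(norm z)\<^sup>2" 1] by simp
  then have "continuous_on S (\<lambda>x. sphere_pt (Fin (f x)))"
    using f by (auto intro!: continuous_intros)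
  then show ?thesis
    unfolding continuous_on_def by (simp only: tendsto_sphere_pt_iff[symmetric])
qed

text \<open>The inverse of \<open>Fin\<close>, made total by a placeholder at \<open>Infty\<close>.
  It lets growth be stated as an inequality between moduli without naming the image point.\<close>

primrec the_fin :: "riemann_sphere \<Rightarrow> complex" where
  "the_fin (Fin z) = z"
| "the_fin Infty = 0"

lemma snd_sphere_pt_less_1: "x \<noteq> Infty \<Longrightarrow> snd (sphere_pt x) < 1"
proof (cases x)
  case (Fin z)
  have "(norm z)\<^sup>2 + 1 > 0" by (simp add: add_nonneg_pos)
  then show ?thesis using Fin by (simp add: field_simps)
qed simp

text \<open>This is stereographic projection from the north pole; in this form
  \<open>the_fin\<close> inherits continuity from \<open>sphere_pt\<close>.\<close>

lemma the_fin_eq: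
  assumes "x \<noteq> Infty"
  shows "the_fin x = (1 / (1 - snd (sphere_pt x))) *\<^sub>R fst (sphere_pt x)"
proof (cases x)
  case (Fin z)
  have "(norm z)\<^sup>2 + 1 > 0" by (simp add: add_nonneg_pos)
  then have "1 - snd (sphere_pt x) = 2 / ((norm z)\<^sup>2 + 1)"
    using Fin by (simp add: field_simps)
  moreover have "(1 / (2 / a)) *\<^sub>R (2 / a) *\<^sub>R z = z" if "a > 0" for a :: real
    using that by simp
  ultimately show ?thesis using Fin \<open>(norm z)\<^sup>2 + 1 > 0\<close> by (metis fst_conv sphere_pt.simps(1) the_fin.simps(1))
qed (use assms in simp)

lemma open_not_Infty: "open (- {Infty})"
  by (simp add: open_Compl)

lemma continuous_on_the_fin: "continuous_on (- {Infty}) the_fin"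
proof -
  have "continuous_on (- {Infty}) sphere_pt"
    unfolding continuous_on_def
    using tendsto_sphere_pt_iff[of "\<lambda>x. x"] tendsto_ident_at by blast
  moreover have "1 - snd (sphere_pt x) \<noteq> 0" if "x \<in> - {Infty}" for x
    using snd_sphere_pt_less_1[of x] that by auto
  ultimately have "continuous_on (- {Infty})
      (\<lambda>x. (1 / (1 - snd (sphere_pt x))) *\<^sub>R fst (sphere_pt x))"
    by (intro continuous_intros) auto
  then show ?thesis by (rule continuous_on_eq) (simp add: the_fin_eq)
qed

lemma open_vimage_Fin: "open S \<Longrightarrow> open (Fin -` S)"
  using continuous_on_Fin[OF continuous_on_id] open_vimage by blast

section \<open>Neighbourhoods of infinity in terms of the modulus\<close>

lemma dist_Fin_Infty:
  "dist (Fin z) Infty = arccos (1 - 2 / ((norm z)\<^sup>2 + 1))"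
proof -
  have "(norm z)\<^sup>2 + 1 > 0" by (simp add: add_nonneg_pos)
  then have "((norm z)\<^sup>2 - 1) / ((norm z)\<^sup>2 + 1) = 1 - 2 / ((norm z)\<^sup>2 + 1)"
    by (simp add: field_simps)
  then show ?thesis by (simp add: dist_riemann_sphere_def)
qed

lemma dist_Fin_Infty_strict_antimono:
  assumes "norm z < norm w" shows "dist (Fin w) Infty < dist (Fin z) Infty"
proof -
  have "(norm z)\<^sup>2 < (norm w)\<^sup>2" using assms by (simp add: power_strict_mono)
  then have less: "2 / ((norm w)\<^sup>2 + 1) < 2 / ((norm z)\<^sup>2 + 1)"
    by (intro divide_strict_left_mono) (auto intro!: mult_pos_pos add_nonneg_pos)
  have "0 \<le> 2 / ((norm u)\<^sup>2 + 1)" "2 / ((norm u)\<^sup>2 + 1) \<le> 2" for u :: complex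
    using add_nonneg_pos[of "(norm u)\<^sup>2" 1] by (simp_all add: divide_le_eq)
  from less this[of z] this[of w] show ?thesis
    unfolding dist_Fin_Infty by (intro arccos_less_arccos) linarith+
qed

text \<open>Makes modulus and distance to infinity interchangeable; the escape estimates pass back
  and forth through it.\<close>

lemma dist_Fin_Infty_less_iff:
  "dist (Fin w) Infty < dist (Fin z) Infty \<longleftrightarrow> norm z < norm w"
proof
  assume less: "dist (Fin w) Infty < dist (Fin z) Infty"
  show "norm z < norm w"
  proof (rule ccontr)
    assume "\<not> norm z < norm w"
    then consider "norm w < norm z" | "norm w = norm z" by linarith
    then show False
    proof cases
      case 1
      then show False using dist_Fin_Infty_strict_antimono[of w z] less by simp
    next
      case 2
      then show False using less by (simp add: dist_Fin_Infty)
    qed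
  qed
qed (rule dist_Fin_Infty_strict_antimono)

lemma dist_Fin_Infty_le_iff:
  "dist (Fin w) Infty \<le> dist (Fin z) Infty \<longleftrightarrow> norm z \<le> norm w"
  using dist_Fin_Infty_less_iff[of z w] by (meson not_le)

lemma tendsto_Fin_Infty_iff:
  "((\<lambda>t. Fin (f t)) \<longlongrightarrow> Infty) F \<longleftrightarrow> filterlim f at_infinity F"
proof
  assume "((\<lambda>t. Fin (f t)) \<longlongrightarrow> Infty) F"
  then have ev: "\<forall>\<^sub>F t in F. dist (Fin (f t)) Infty < dist (Fin (of_real r)) Infty" for r
    by (rule tendstoD) simp
  have "\<forall>\<^sub>F t in F. r \<le> norm (f t)" for r
    by (rule eventually_mono[OF ev[of r]])
      (simp add: dist_Fin_Infty_less_iff)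
  then show "filterlim f at_infinity F"
    by (auto simp: filterlim_at_infinity[of 0])
next
  assume "filterlim f at_infinity F"
  then have "filterlim (\<lambda>t. norm (f t)) at_top F"
    by (rule filterlim_at_infinity_imp_norm_at_top)
  then have "filterlim (\<lambda>t. (norm (f t))\<^sup>2) at_top F"
    by (intro filterlim_pow_at_top) simp_all
  then have f: "filterlim (\<lambda>t. (norm (f t))\<^sup>2 + 1) at_top F"
    by (rule filterlim_at_top_mono) simp
  have "((\<lambda>t. 1 - 2 / ((norm (f t))\<^sup>2 + 1)) \<longlongrightarrow> 1 - 0) F"
    by (intro tendsto_diff tendsto_const tendsto_divide_0[OF tendsto_const]
        filterlim_at_top_imp_at_infinity f)
  moreover have "1 - 2 / ((norm (f t))\<^sup>2 + 1) \<in> {-1..1}" for t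
    using add_nonneg_pos[of "(norm (f t))\<^sup>2" 1] by (simp add: divide_le_eq)
  ultimately have "((\<lambda>t. arccos (1 - 2 / ((norm (f t))\<^sup>2 + 1))) \<longlongrightarrow> arccos 1) F"
    by (intro continuous_on_tendsto_compose[OF continuous_on_arccos'] always_eventually) auto
  then show "((\<lambda>t. Fin (f t)) \<longlongrightarrow> Infty) F"
    unfolding tendsto_dist_iff[of "\<lambda>t. Fin (f t)"] dist_Fin_Infty by simp
qed

lemma dist_Fin_Infty_small:
  assumes "e > 0" obtains r where "r > 0" "\<And>z. norm z \<ge> r \<Longrightarrow> dist (Fin z) Infty < e"
proof -
  have "((\<lambda>z. Fin z) \<longlongrightarrow> Infty) at_infinity"
    by (simp add: tendsto_Fin_Infty_iff filterlim_ident)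
  then have "\<forall>\<^sub>F z in at_infinity. dist (Fin z) Infty < e"
    using assms by (rule tendstoD)
  then show thesis
    using that unfolding eventually_at_infinity_pos by blast
qed

text \<open>For \<open>r \<ge> 0\<close> these are the open discs about infinity, labelled by
  Euclidean radius. For negative \<open>r\<close> the set is the whole sphere, which is how
  connectedness of the sphere is obtained.\<close>

definition sphere_outside :: "real \<Rightarrow> riemann_sphere set" where
  "sphere_outside r = insert Infty (Fin ` {z. norm z > r})"

lemma Infty_in_sphere_outside [simp]: "Infty \<in> sphere_outside r"
  and Fin_in_sphere_outside_iff [simp]: "Fin z \<in> sphere_outside r \<longleftrightarrow> norm z > r"
  by (auto simp: sphere_outside_def)

lemma sphere_outside_eq_ball:
  assumes "r \<ge> 0"
  shows "sphere_outside r = ball Infty (dist (Fin (of_real r)) Infty)"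
proof (rule set_eqI)
  fix x show "x \<in> sphere_outside r \<longleftrightarrow> x \<in> ball Infty (dist (Fin (of_real r)) Infty)"
    using assms by (cases x) (simp_all add: dist_commute[of Infty] dist_Fin_Infty_less_iff)
qed

lemma open_sphere_outside: "r \<ge> 0 \<Longrightarrow> open (sphere_outside r)"
  by (simp add: sphere_outside_eq_ball)

lemma open_Infty_contains_sphere_outside:
  assumes "open S" "Infty \<in> S"
  obtains r where "r > 0" "sphere_outside r \<subseteq> S"
proof -
  obtain e where e: "e > 0" "ball Infty e \<subseteq> S" using assms open_contains_ball by blast
  obtain r where r: "r > 0" "\<And>z. norm z \<ge> r \<Longrightarrow> dist (Fin z) Infty < e"
    using dist_Fin_Infty_small[OF e(1)] by blast
  have "sphere_outside r \<subseteq> ball Infty e"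
    using r e by (auto simp: sphere_outside_def dist_commute[of Infty])
  with r e that show thesis by blast
qed

text \<open>The exterior of a disc in the plane is connected, and adding its limit point
  \<open>Infty\<close> keeps it so.\<close>

lemma connected_sphere_outside: "connected (sphere_outside r)"
proof -
  have eq: "{z::complex. norm z > r} = - cball 0 r" by auto
  have conn: "connected (Fin ` {z. norm z > r})"
    unfolding eq
    by (intro connected_continuous_image continuous_intros connected_complement_bounded_convex)
      auto
  have "Infty \<in> closure (Fin ` {z. norm z > r})"
    unfolding closure_approachable
  proof (intro allI impI)
    fix e :: real assume "e > 0"
    then obtain s where s: "s > 0" "\<And>z. norm z \<ge> s \<Longrightarrow> dist (Fin z) Infty < e"
      using dist_Fin_Infty_small by blast
    then show "\<exists>y\<in>Fin ` {z. norm z > r}. dist y Infty < e"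
      by (intro bexI[of _ "Fin (of_real (max s (\<bar>r\<bar> + 1)))"]) auto
  qed
  then show ?thesis
    unfolding sphere_outside_def
    by (intro connected_intermediate_closure[OF conn]) (auto simp: closure_subset[THEN subsetD])
qed

lemma connected_UNIV_sphere: "connected (UNIV :: riemann_sphere set)"
proof -
  have "sphere_outside (-1) = UNIV"
    by (rule set_eqI, case_tac x) (auto intro: less_le_trans[of _ 0])
  then show ?thesis using connected_sphere_outside[of "-1"] by simp
qed

section \<open>Compactness and second countability of the sphere\<close>

lemma sphere_pt_surj:
  assumes "norm p = 1" shows "\<exists>x. sphere_pt x = p"
proof (cases p)
  case (Pair z t)
  have n: "(norm z)\<^sup>2 + t\<^sup>2 = 1" using assms Pair by (simp add: norm_Pair)
  show ?thesis
  proof (cases "t = 1")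
    case True
    then show ?thesis using n Pair by (intro exI[of _ Infty]) simp
  next
    case False
    have "t\<^sup>2 \<le> 1" using n by (metis add.commute le_add_same_cancel1 zero_le_power2)
    then have "\<bar>t\<bar> \<le> 1" by (simp add: abs_square_le_1)
    with False have t: "1 - t > 0" by auto
    have sq: "(norm z / (1 - t))\<^sup>2 = (1 + t) / (1 - t)"
    proof -
      have "(norm z)\<^sup>2 = (1 + t) * (1 - t)" using n by (simp add: algebra_simps power2_eq_square)
      then show ?thesis using t by (simp add: power_divide power2_eq_square)
    qed
    have a: "(norm z / (1 - t))\<^sup>2 + 1 = 2 / (1 - t)"
      unfolding sq using t by (simp add: field_simps)
    have b: "(norm z / (1 - t))\<^sup>2 - 1 = 2 * t / (1 - t)"
      unfolding sq using t by (simp add: field_simps)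
    have "sphere_pt (Fin ((1 / (1 - t)) *\<^sub>R z)) = p"
      using t Pair a b by simp
    then show ?thesis by blast
  qed
qed

lemma compact_UNIV_sphere: "compact (UNIV :: riemann_sphere set)"
proof -
  have "\<exists>l r. strict_mono r \<and> (X \<circ> r) \<longlonglongrightarrow> l" for X :: "nat \<Rightarrow> riemann_sphere"
  proof -
    have "seq_compact (sphere 0 1 :: (complex \<times> real) set)"
      using compact_sphere compact_imp_seq_compact by blast
    then obtain p r where p: "p \<in> sphere 0 1" "strict_mono r" "((\<lambda>n. sphere_pt (X n)) \<circ> r) \<longlonglongrightarrow> p"
      by (rule seq_compactE[where f = "\<lambda>n. sphere_pt (X n)"]) auto
    then obtain l where "sphere_pt l = p" using sphere_pt_surj[of p] by auto
    then show ?thesis using p tendsto_sphere_pt_iff[of "X \<circ> r" l sequentially]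
      by (auto simp: o_def)
  qed
  then show ?thesis
    unfolding compact_eq_seq_compact_metric seq_compact_def by auto
qed

lemma compact_sphere_iff: "compact (S :: riemann_sphere set) \<longleftrightarrow> closed S"
  using compact_UNIV_sphere compact_imp_closed compact_Int_closed[of UNIV S] by auto

text \<open>Needed for measurability of orbits and distances, and later for a countable dense set
  that meets every open set where \<open>T\<close> is constant.\<close>

instance riemann_sphere :: second_countable_topology
proof
  obtain D :: "complex set" where D: "countable D" "\<And>X. open X \<Longrightarrow> X \<noteq> {} \<Longrightarrow> \<exists>d\<in>D. d \<in> X"
    using countable_dense_setE by blast
  show "\<exists>B::riemann_sphere set set. countable B \<and> open = generate_topology B"
  proof (rule countable_dense_imp_countable_subbasis[of "Fin ` D"])
    fix x :: riemann_sphere and e :: real assume e: "e > 0"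
    have "Fin -` ball x e \<noteq> {}"
    proof (cases x)
      case (Fin z)
      then have "z \<in> Fin -` ball x e" using e by simp
      then show ?thesis by blast
    next
      case Infty
      obtain s where "s > 0" "\<And>z. norm z \<ge> s \<Longrightarrow> dist (Fin z) Infty < e"
        using dist_Fin_Infty_small e by blast
      then have "Fin (of_real s) \<in> ball x e" using Infty by (simp add: dist_commute)
      then show ?thesis by auto
    qed
    then obtain d where "d \<in> D" "d \<in> Fin -` ball x e"
      using D(2)[OF open_vimage_Fin[OF open_ball]] by blast
    then show "\<exists>d\<in>Fin ` D. dist d x < e" by (auto simp: dist_commute)
  qed (use D in simp)
qed

section \<open>Polynomial maps\<close>

lemma app_pm_cases:
  obtains p where "degree p \<ge> 2" "app_pm f = poly_on_sphere p"
  using app_pm[of f] by blast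

lemma app_pm_Infty [simp]: "app_pm f Infty = Infty"
  by (metis app_pm_cases poly_on_sphere.simps(2))

lemma app_pm_Fin: obtains w where "app_pm f (Fin z) = Fin w"
  by (metis app_pm_cases poly_on_sphere.simps(1))

lemma dist_app_pm_le: "dist (app_pm f z) (app_pm g z) \<le> dist f g"
  unfolding dist_polynomial_map_def by (rule cSUP_upper[OF UNIV_I bdd_above_dist_app_pm])

text \<open>Behaviour at infinity is read off at 0 from the reflected polynomial, whose value there
  is the leading coefficient. Taking \<open>c\<close> as half its modulus leaves room for
  continuity.\<close>

lemma poly_growth:
  fixes p :: "complex poly"
  assumes "p \<noteq> 0"
  obtains c R where "c > 0" "R \<ge> 1" "\<And>z. norm z \<ge> R \<Longrightarrow> norm (poly p z) \<ge> c * norm z ^ degree p"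
proof -
  define c where "c = norm (lead_coeff p) / 2"
  have c: "c > 0" using assms by (simp add: c_def)
  have "isCont (\<lambda>w. norm (poly (reflect_poly p) w)) 0" by (intro continuous_intros)
  then have "((\<lambda>w. norm (poly (reflect_poly p) w)) \<longlongrightarrow> 2 * c) (at 0)"
    by (simp add: isCont_def c_def)
  then have "\<forall>\<^sub>F w in at 0. norm (poly (reflect_poly p) w) > c"
    using c by (intro order_tendstoD(1)) auto
  then obtain d where d: "d > 0" "\<And>w. w \<noteq> 0 \<Longrightarrow> dist w 0 < d \<Longrightarrow> norm (poly (reflect_poly p) w) > c"
    unfolding eventually_at by auto
  show thesis
  proof
    fix z :: complex assume z: "norm z \<ge> max 1 (2 / d)"
    then have "z \<noteq> 0" by auto
    have "2 / d \<le> norm z" using z by simp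
    then have "norm (inverse z) \<le> d / 2"
      unfolding norm_inverse using d(1) \<open>z \<noteq> 0\<close> by (simp add: field_simps)
    then have "c < norm (poly (reflect_poly p) (inverse z))"
      using d \<open>z \<noteq> 0\<close> by (intro d(2)) auto
    also have "\<dots> = norm (poly p z) / norm z ^ degree p"
      using \<open>z \<noteq> 0\<close> by (simp add: poly_reflect_poly_nz norm_mult norm_power norm_inverse power_inverse divide_inverse)
    finally show "norm (poly p z) \<ge> c * norm z ^ degree p"
      using \<open>z \<noteq> 0\<close> by (simp add: field_simps)
  qed (use c in auto)
qed

text \<open>Degree at least 2 beats every linear rate. The factor \<open>C\<close> stays free:
  continuity at infinity takes it from the target neighbourhood, the escape radius takes 3.\<close>

lemma poly_growth_linear:
  fixes p :: "complex poly"
  assumes "degree p \<ge> 2"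
  obtains R where "R \<ge> 1" "\<And>z. norm z \<ge> R \<Longrightarrow> norm (poly p z) \<ge> C * norm z"
proof -
  have "p \<noteq> 0" using assms by auto
  then obtain c R where c: "c > 0" "R \<ge> 1"
    "\<And>z. norm z \<ge> R \<Longrightarrow> norm (poly p z) \<ge> c * norm z ^ degree p"
    using poly_growth by blast
  show thesis
  proof
    fix z :: complex assume z: "norm z \<ge> max R (C / c)"
    then have "C / c \<le> norm z" by simp
    then have "C \<le> c * norm z" using c by (simp add: field_simps)
    then have "C * norm z \<le> c * norm z ^ 2"
      using mult_right_mono[of C "c * norm z" "norm z"] by (simp add: power2_eq_square)
    also have "\<dots> \<le> c * norm z ^ degree p"
      using z c assms by (intro mult_left_mono power_increasing) auto
    also have "\<dots> \<le> norm (poly p z)" using z c by simp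
    finally show "norm (poly p z) \<ge> C * norm z" .
  qed (use c in auto)
qed

lemma continuous_on_poly_on_sphere:
  assumes p: "degree p \<ge> 2"
  shows "continuous_on UNIV (poly_on_sphere p)"
  unfolding continuous_on_eq_continuous_at[OF open_UNIV]
proof
  fix x
  show "isCont (poly_on_sphere p) x"
  proof (cases x)
    case (Fin z)
    have "continuous_on (- {Infty}) (\<lambda>x. Fin (poly p (the_fin x)))"
      by (intro continuous_intros continuous_on_poly continuous_on_the_fin)
    moreover have "Fin (poly p (the_fin x)) = poly_on_sphere p x" if "x \<in> - {Infty}" for x
      using that by (cases x) auto
    ultimately have "continuous_on (- {Infty}) (poly_on_sphere p)"
      by (rule continuous_on_eq)
    then show ?thesis
      using Fin by (simp add: continuous_on_eq_continuous_at[OF open_not_Infty])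
  next
    case Infty
    have "(poly_on_sphere p \<longlongrightarrow> Infty) (at Infty)"
    proof (rule tendstoI)
      fix e :: real assume "e > 0"
      then obtain r where r: "r > 0" "\<And>z. norm z \<ge> r \<Longrightarrow> dist (Fin z) Infty < e"
        using dist_Fin_Infty_small by blast
      obtain R where R: "R \<ge> 1" "\<And>z. norm z \<ge> R \<Longrightarrow> norm (poly p z) \<ge> r * norm z"
        using poly_growth_linear[OF p] by blast
      have "dist (poly_on_sphere p x) Infty < e" if "x \<in> sphere_outside R" for x
      proof (cases x)
        case (Fin z)
        then have z: "norm z > R" using that by simp
        have "r \<le> r * norm z" using R(1) r(1) z by simp
        also have "\<dots> \<le> norm (poly p z)" using R(2) z by simp
        finally show ?thesis using r Fin by simp
      qed (use \<open>e > 0\<close> in simp)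
      moreover have "\<forall>\<^sub>F x in at Infty. x \<in> sphere_outside R"
        using open_sphere_outside[of R] R(1) by (intro eventually_at_in_open') auto
      ultimately show "\<forall>\<^sub>F x in at Infty. dist (poly_on_sphere p x) Infty < e"
        by (auto elim: eventually_mono)
    qed
    then show ?thesis using Infty by (simp add: isCont_def)
  qed
qed

lemma continuous_on_app_pm: "continuous_on S (app_pm f)"
  by (metis app_pm_cases continuous_on_poly_on_sphere continuous_on_subset top_greatest)

text \<open>The metric on maps is a supremum, so changing the map costs at most
  \<open>dist (fst x) f\<close> at whatever point it is evaluated; what remains is continuity of the
  single map \<open>f\<close>.\<close>

lemma continuous_on_app_pm_pair: "continuous_on S (\<lambda>x. app_pm (fst x) (snd x))"
proof -
  have "isCont (\<lambda>x. app_pm (fst x) (snd x)) (f, z)" for f z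
  proof -
    have "isCont (app_pm f) z"
      using continuous_on_app_pm[of UNIV f] by (simp add: continuous_on_eq_continuous_at)
    moreover have "isCont snd (f, z)" by (intro continuous_intros)
    ultimately have "isCont (\<lambda>x. app_pm f (snd x)) (f, z)"
      using isCont_o2[where f = snd and g = "app_pm f" and a = "(f, z)"] by simp
    then have "((\<lambda>x. app_pm f (snd x)) \<longlongrightarrow> app_pm f z) (at (f, z))"
      by (simp add: isCont_def)
    then have "((\<lambda>x. dist (app_pm f (snd x)) (app_pm f z)) \<longlongrightarrow> 0) (at (f, z))"
      by (rule tendsto_dist_iff[THEN iffD1])
    moreover have "(fst \<longlongrightarrow> f) (at (f, z))"
      using tendsto_fst[OF tendsto_ident_at, of "(f, z)" UNIV] by simp
    then have "((\<lambda>x. dist (fst x) f) \<longlongrightarrow> 0) (at (f, z))"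
      by (rule tendsto_dist_iff[THEN iffD1])
    ultimately have lim: "((\<lambda>x. dist (fst x) f + dist (app_pm f (snd x)) (app_pm f z)) \<longlongrightarrow> 0) (at (f, z))"
      using tendsto_add_zero by blast
    have "dist (app_pm (fst x) (snd x)) (app_pm f z)
        \<le> dist (fst x) f + dist (app_pm f (snd x)) (app_pm f z)" for x
      using dist_triangle[of "app_pm (fst x) (snd x)" "app_pm f z" "app_pm f (snd x)"]
        dist_app_pm_le[of "fst x" "snd x" f] by linarith
    then have "((\<lambda>x. dist (app_pm (fst x) (snd x)) (app_pm f z)) \<longlongrightarrow> 0) (at (f, z))"
      by (intro tendsto_sandwich[OF _ _ tendsto_const lim] always_eventually) auto
    then show ?thesis
      unfolding isCont_def by (simp add: tendsto_dist_iff[of "\<lambda>x. app_pm (fst x) (snd x)"])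
  qed
  then have "continuous_on UNIV (\<lambda>x. app_pm (fst x) (snd x))"
    by (auto simp: continuous_on_eq_continuous_at)
  then show ?thesis using continuous_on_subset by blast
qed

lemma compact_imp_uniformly_equicontinuous:
  assumes "compact K" "e > 0"
  obtains d where "d > 0"
    "\<And>f x y. f \<in> K \<Longrightarrow> dist x y < d \<Longrightarrow> dist (app_pm f x) (app_pm f y) < e"
proof -
  have "uniformly_continuous_on (K \<times> UNIV) (\<lambda>x. app_pm (fst x) (snd x))"
    using assms compact_UNIV_sphere
    by (intro compact_uniformly_continuous continuous_on_app_pm_pair compact_Times)
  then obtain d where "d > 0"
    "\<And>u v. u \<in> K \<times> UNIV \<Longrightarrow> v \<in> K \<times> UNIV \<Longrightarrow> dist v u < d \<Longrightarrow>
      dist (app_pm (fst v) (snd v)) (app_pm (fst u) (snd u)) < e"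
    using assms(2) unfolding uniformly_continuous_on_def by metis
  note d = this
  show thesis
    using d(1) d(2)[of "(f, y)" "(f, x)" for f x y] by (intro that) (auto simp: dist_Pair_Pair)
qed

section \<open>Second countability of the space of polynomial maps\<close>

lemma norm_poly_le:
  fixes p :: "complex poly"
  assumes "degree p \<le> d" "\<And>i. norm (coeff p i) \<le> e" "norm z \<le> r" "1 \<le> r"
  shows "norm (poly p z) \<le> real (Suc d) * e * r ^ d"
proof -
  have "poly p z = (\<Sum>i\<le>d. coeff p i * z ^ i)"
    unfolding poly_altdef
    using assms(1) by (intro sum.mono_neutral_left) (auto simp: coeff_eq_0)
  also have "norm \<dots> \<le> (\<Sum>i\<le>d. e * r ^ d)"
  proof (rule sum_norm_le)
    fix i assume "i \<in> {..d}"
    have "norm z ^ i \<le> r ^ i" using assms by (intro power_mono) auto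
    also have "\<dots> \<le> r ^ d" using \<open>i \<in> {..d}\<close> assms by (intro power_increasing) auto
    finally show "norm (coeff p i * z ^ i) \<le> e * r ^ d"
      unfolding norm_mult norm_power
      using assms(2)[of i] order_trans[OF norm_ge_zero assms(2)[of i]] by (intro mult_mono) auto
  qed
  finally show ?thesis by simp
qed

text \<open>On a large disc both values lie in a bounded set where \<open>Fin\<close> is uniformly
  continuous; outside it both are so large that they are close to \<open>Infty\<close>. The degree
  bound is essential: a tiny coefficient of higher degree would create a zero of \<open>q\<close>
  where \<open>p\<close> is huge.\<close>

lemma poly_on_sphere_close:
  assumes p: "degree p \<ge> 2" and e: "e > 0"
  obtains \<delta> where "\<delta> > 0"
    "\<And>q z. degree q \<le> degree p \<Longrightarrow> (\<And>i. norm (coeff q i - coeff p i) \<le> \<delta>) \<Longrightarrow>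
      dist (poly_on_sphere p z) (poly_on_sphere q z) \<le> e"
proof -
  define d where "d = degree p"
  have "p \<noteq> 0" using p by auto
  then obtain c R1 where c: "c > 0" "R1 \<ge> 1"
    "\<And>z. norm z \<ge> R1 \<Longrightarrow> norm (poly p z) \<ge> c * norm z ^ d"
    using poly_growth unfolding d_def by blast
  obtain M where M: "M > 0" "\<And>z. norm z \<ge> M \<Longrightarrow> dist (Fin z) Infty < e / 2"
    using dist_Fin_Infty_small[of "e / 2"] e by auto
  define R where "R = max R1 (2 * M / c)"
  have "bounded (poly p ` cball 0 R)"
    by (intro compact_imp_bounded compact_continuous_image continuous_on_poly continuous_on_id) auto
  then obtain K where "\<forall>z\<in>cball 0 R. norm (poly p z) \<le> K"
    unfolding bounded_iff by auto
  then have K: "norm (poly p z) \<le> K" if "norm z \<le> R" for z using that by simp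
  have "uniformly_continuous_on (cball 0 (K + 1)) Fin"
    by (intro compact_uniformly_continuous continuous_on_Fin continuous_on_id) auto
  then obtain \<eta> where \<eta>: "\<eta> > 0"
    "\<And>a b. norm a \<le> K + 1 \<Longrightarrow> norm b \<le> K + 1 \<Longrightarrow> dist a b < \<eta> \<Longrightarrow> dist (Fin a) (Fin b) < e"
    using e unfolding uniformly_continuous_on_def
    by (metis mem_cball_0)
  \<comment> \<open>The bound \<open>c / 2\<close> keeps half of the growth of \<open>p\<close> for
    \<open>q\<close> outside radius \<open>R\<close>, and \<open>R\<close> was chosen so that this
    half exceeds \<open>M\<close>. The other bound keeps the error on the disc of radius
    \<open>R\<close> below \<open>\<eta>\<close> and at most 1.\<close>
  define s where "s = min (c / 2) (min (\<eta> / 2) 1 / R ^ d)"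
  have R: "R \<ge> 1" using c by (simp add: R_def)
  have s: "s > 0" using c \<eta> R by (simp add: s_def)
  show thesis
  proof (rule that[of "s / real (Suc d)"])
    fix q z assume dq: "degree q \<le> degree p"
      and q: "\<And>i. norm (coeff q i - coeff p i) \<le> s / real (Suc d)"
    have diff: "norm (poly q z - poly p z) \<le> s * r ^ d" if "norm z \<le> r" "1 \<le> r" for z r
    proof -
      have "norm (poly (q - p) z) \<le> real (Suc d) * (s / real (Suc d)) * r ^ d"
        using that dq q by (intro norm_poly_le) (auto simp: d_def intro!: degree_diff_le)
      then show ?thesis by simp
    qed
    show "dist (poly_on_sphere p z) (poly_on_sphere q z) \<le> e"
    proof (cases z)
      case (Fin w)
      show ?thesis
      proof (cases "norm w \<ge> R")
        case True
        then have w: "norm w \<ge> R1" "norm w \<ge> 1" "2 * M / c \<le> norm w" using R by (auto simp: R_def)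
        have "M \<le> c / 2 * norm w" using w(3) c(1) by (simp add: field_simps)
        also have "\<dots> \<le> c / 2 * norm w ^ d"
          using w p c by (intro mult_left_mono self_le_power) (auto simp: d_def)
        finally have "M \<le> c / 2 * norm w ^ d" .
        moreover have "s * norm w ^ d \<le> c / 2 * norm w ^ d"
          by (intro mult_right_mono) (auto simp: s_def)
        moreover have "c * norm w ^ d = c / 2 * norm w ^ d + c / 2 * norm w ^ d" by simp
        moreover have "c * norm w ^ d \<le> norm (poly p w)" using c w by simp
        moreover have "norm (poly p w) \<le> norm (poly q w) + norm (poly q w - poly p w)"
          by (metis norm_minus_commute norm_triangle_sub)
        moreover have "norm (poly q w - poly p w) \<le> s * norm w ^ d" using diff w by simp
        moreover have "0 < M" by fact
        ultimately have "M \<le> norm (poly p w)" "M \<le> norm (poly q w)" by linarith+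
        then have "dist (Fin (poly p w)) Infty < e / 2" "dist (Fin (poly q w)) Infty < e / 2"
          using M by auto
        then show ?thesis
          using dist_triangle2[of "Fin (poly p w)" "Fin (poly q w)" Infty] Fin by simp
      next
        case False
        then have "norm (poly q w - poly p w) \<le> s * R ^ d" using diff R by simp
        also have "\<dots> \<le> min (\<eta> / 2) 1 / R ^ d * R ^ d"
          using R by (intro mult_right_mono) (auto simp: s_def)
        also have "\<dots> = min (\<eta> / 2) 1" using R by simp
        finally have "norm (poly q w - poly p w) \<le> \<eta> / 2" "norm (poly q w - poly p w) \<le> 1" by auto
        moreover have "norm (poly p w) \<le> K" using K False by simp
        moreover have "norm (poly q w) \<le> norm (poly p w) + norm (poly q w - poly p w)"
          by (metis norm_triangle_sub)
        ultimately have "dist (Fin (poly p w)) (Fin (poly q w)) < e"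
          using \<eta>(1) by (intro \<eta>(2)) (auto simp: dist_norm norm_minus_commute)
        then show ?thesis using Fin by simp
      qed
    qed (use e in simp)
  qed (use s in simp)
qed

text \<open>The dense set consists of the polynomials with coefficients in a countable dense subset
  of the plane. The instance is what makes the topological support carry full measure.\<close>

instance polynomial_map :: second_countable_topology
proof
  obtain D :: "complex set" where D: "countable D" "\<And>X. open X \<Longrightarrow> X \<noteq> {} \<Longrightarrow> \<exists>d\<in>D. d \<in> X"
    using countable_dense_setE by blast
  define E where "E = (\<lambda>xs. Abs_polynomial_map (poly_on_sphere (Poly xs)))
      ` {xs \<in> lists D. degree (Poly xs) \<ge> 2}"
  show "\<exists>B::polynomial_map set set. countable B \<and> open = generate_topology B"
  proof (rule countable_dense_imp_countable_subbasis[of E])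
    have "countable {xs \<in> lists D. degree (Poly xs) \<ge> 2}"
      by (rule countable_subset[OF _ countable_lists[OF D(1)]]) auto
    then show "countable E" unfolding E_def by simp
    fix f :: polynomial_map and e :: real assume e: "e > 0"
    obtain p where p: "degree p \<ge> 2" "app_pm f = poly_on_sphere p" by (rule app_pm_cases)
    obtain \<delta> where \<delta>: "\<delta> > 0"
      "\<And>q z. degree q \<le> degree p \<Longrightarrow> (\<And>i. norm (coeff q i - coeff p i) \<le> \<delta>) \<Longrightarrow>
        dist (poly_on_sphere p z) (poly_on_sphere q z) \<le> e / 2"
      using poly_on_sphere_close[of p "e / 2"] p e by (metis half_gt_zero)
    \<comment> \<open>The second bound makes the approximating leading coefficient nonzero, so the
      approximation keeps the degree of \<open>p\<close>.\<close>
    define r where "r = min \<delta> (norm (lead_coeff p))"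
    have r: "r > 0" using \<delta> p by (auto simp: r_def)
    have "\<exists>c\<in>D. c \<in> ball (coeff p i) r" for i using D(2)[OF open_ball] r by simp
    then obtain c where c: "\<And>i. c i \<in> D" "\<And>i. dist (coeff p i) (c i) < r" by (auto; metis)
    define xs where "xs = map c [0..<Suc (degree p)]"
    have coeff: "coeff (Poly xs) i = (if i \<le> degree p then c i else 0)" for i
      by (auto simp: xs_def coeff_Poly_eq nth_default_def simp del: upt_Suc)
    have le: "degree (Poly xs) \<le> degree p" by (rule degree_le) (simp add: coeff del: coeff_Poly_eq)
    have "c (degree p) \<noteq> 0" using c(2)[of "degree p"] by (auto simp: r_def)
    then have "degree p \<le> degree (Poly xs)" by (intro le_degree) (simp add: coeff del: coeff_Poly_eq)
    then have deg: "degree (Poly xs) \<ge> 2" using p by simp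
    let ?g = "Abs_polynomial_map (poly_on_sphere (Poly xs))"
    have g: "app_pm ?g = poly_on_sphere (Poly xs)"
      using deg by (intro Abs_polynomial_map_inverse) auto
    have "norm (coeff (Poly xs) i - coeff p i) \<le> \<delta>" for i
      using c(2)[of i] \<delta>(1) by (auto simp: coeff coeff_eq_0 dist_norm norm_minus_commute r_def simp del: coeff_Poly_eq)
    then have "dist f ?g \<le> e / 2"
      unfolding dist_polynomial_map_def p g using \<delta>(2)[OF le] by (intro cSUP_least) auto
    moreover have "xs \<in> lists D" using c(1) by (auto simp: xs_def)
    then have "?g \<in> E" unfolding E_def using deg by blast
    ultimately show "\<exists>g\<in>E. dist g f < e"
      using e by (intro bexI[of _ ?g]) (auto simp: dist_commute)
  qed
qed

text \<open>For \<open>g\<close> near \<open>f\<close> uniform closeness alone only gives a bound \<open>\<bar>g z\<bar> > 2 R\<close> for \<open>\<bar>z\<bar> \<ge> R\<close>, with \<open>R\<close>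
  independent of \<open>g\<close>. It extends to \<open>\<bar>g z\<bar> \<ge> 2 \<bar>z\<bar>\<close> by the maximum modulus principle for \<open>z / g z\<close> in
  the coordinate \<open>1 / z\<close>.\<close>

lemma escape_radius_nbhd:
  obtains R e where "R \<ge> 1" "e > 0"
    "\<And>g z. dist f g < e \<Longrightarrow> norm z \<ge> R \<Longrightarrow> norm (the_fin (app_pm g (Fin z))) \<ge> 2 * norm z"
proof -
  obtain p where p: "degree p \<ge> 2" "app_pm f = poly_on_sphere p" by (rule app_pm_cases)
  obtain R where R: "R \<ge> 1" "\<And>z. norm z \<ge> R \<Longrightarrow> norm (poly p z) \<ge> 3 * norm z"
    using poly_growth_linear[OF p(1), of 3] by blast
  \<comment> \<open>The gap between the circles of radius \<open>2 * R\<close> and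
    \<open>3 * R\<close> as seen from infinity: a value of modulus at least \<open>3 * R\<close>
    moved by less than \<open>e\<close> keeps modulus above \<open>2 * R\<close>.\<close>
  define e where "e = dist (Fin (of_real (2 * R))) Infty - dist (Fin (of_real (3 * R))) Infty"
  have "e > 0"
    using R(1) dist_Fin_Infty_strict_antimono[of "of_real (2 * R)" "of_real (3 * R)"]
    by (simp add: e_def)
  show thesis
  proof (rule that[OF R(1) \<open>e > 0\<close>])
    fix g and z :: complex assume g: "dist f g < e" and z: "norm z \<ge> R"
    obtain q where q: "degree q \<ge> 2" "app_pm g = poly_on_sphere q" by (rule app_pm_cases)
    have large: "norm (poly q z) > 2 * R" if "norm z \<ge> R" for z
    proof -
      have "dist (Fin (poly p z)) (Fin (poly q z)) < e"
        using dist_app_pm_le[of f "Fin z" g] g by (simp add: p q)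
      moreover have "norm (poly p z) \<ge> 3 * R" using R(2)[OF that] that by simp
      then have "dist (Fin (poly p z)) Infty \<le> dist (Fin (of_real (3 * R))) Infty"
        using R(1) by (simp add: dist_Fin_Infty_le_iff del: of_real_mult)
      ultimately have "dist (Fin (poly q z)) Infty < dist (Fin (of_real (2 * R))) Infty"
        using dist_triangle3[of "Fin (poly q z)" Infty "Fin (poly p z)"] by (simp add: e_def)
      then show ?thesis using R(1) by (simp add: dist_Fin_Infty_less_iff del: of_real_mult)
    qed
    define Q where "Q = reflect_poly q"
    have Q: "poly Q w = w ^ degree q * poly q (inverse w)" if "w \<noteq> 0" for w
      using that by (simp add: Q_def poly_reflect_poly_nz)
    have nz: "poly Q w \<noteq> 0" if "w \<in> cball 0 (1 / R)" for w
    proof (cases "w = 0")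
      case True
      then show ?thesis using q by (auto simp: Q_def)
    next
      case False
      then have "norm (inverse w) \<ge> R"
        unfolding norm_inverse using that R(1) by (simp add: field_simps)
      from large[OF this] R(1) have "poly q (inverse w) \<noteq> 0" by auto
      then show ?thesis using Q False by simp
    qed
    \<comment> \<open>Writing the quotient with the reflected polynomial removes the singularity at
      \<open>w = 0\<close>: the denominator has no zero on the disc, and the value at 0 corresponds
      to infinity.\<close>
    define h where "h w = w ^ (degree q - 1) / poly Q w" for w
    have h: "h w = 1 / (w * poly q (inverse w))" if "w \<noteq> 0" for w
    proof -
      have "w ^ degree q = w * w ^ (degree q - 1)"
        using q(1) by (simp flip: power_Suc)
      then show ?thesis using that by (simp add: h_def Q)
    qed
    have "norm (h (inverse z)) \<le> 1 / 2"
    proof (rule maximum_modulus_frontier[of h "cball 0 (1 / R)"])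
      show "h holomorphic_on interior (cball 0 (1 / R))"
        unfolding h_def using nz by (intro holomorphic_intros) auto
      show "continuous_on (closure (cball 0 (1 / R))) h"
        unfolding h_def using nz by (intro continuous_intros) auto
      show "inverse z \<in> cball 0 (1 / R)"
        using le_imp_inverse_le[of R "norm z"] z R(1) by (simp add: norm_divide inverse_eq_divide)
      fix w :: complex assume "w \<in> frontier (cball 0 (1 / R))"
      then have w: "norm w = 1 / R" using R(1) by (simp add: frontier_cball)
      then have "w \<noteq> 0" using R(1) by auto
      have "norm (inverse w) = R" using w by (simp add: norm_inverse)
      then have "2 * R < norm (poly q (inverse w))" using large by simp
      then have "2 \<le> norm (w * poly q (inverse w))"
        using R(1) by (simp add: norm_mult w field_simps)
      then show "norm (h w) \<le> 1 / 2"
        using frac_le[of 1 1 2 "norm (w * poly q (inverse w))"]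
        unfolding h[OF \<open>w \<noteq> 0\<close>] by (simp add: norm_divide)
    qed auto
    moreover have "z \<noteq> 0" using z R(1) by auto
    moreover have "poly q z \<noteq> 0" using large[OF z] R(1) by auto
    ultimately show "norm (the_fin (app_pm g (Fin z))) \<ge> 2 * norm z"
      by (simp add: q h norm_divide norm_mult norm_inverse field_simps)
  qed
qed

lemma escape_radius_compact:
  assumes "compact K"
  obtains R where "R \<ge> 1"
    "\<And>f z. f \<in> K \<Longrightarrow> norm z \<ge> R \<Longrightarrow> norm (the_fin (app_pm f (Fin z))) \<ge> 2 * norm z"
proof -
  have "\<exists>R e. e > 0 \<and> (\<forall>g z. dist f g < e \<longrightarrow> norm z \<ge> R \<longrightarrow>
      norm (the_fin (app_pm g (Fin z))) \<ge> 2 * norm z)" for f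
    using escape_radius_nbhd[of f] by metis
  then obtain R e where Re: "\<And>f. e f > 0" "\<And>f g z. dist f g < e f \<Longrightarrow> norm z \<ge> R f \<Longrightarrow>
      norm (the_fin (app_pm g (Fin z))) \<ge> 2 * norm z"
    by metis
  obtain C where C: "finite C" "C \<subseteq> K" "K \<subseteq> (\<Union>f\<in>C. ball f (e f))"
  proof (rule compactE_image[OF assms, of K "\<lambda>f. ball f (e f)"])
    show "K \<subseteq> (\<Union>f\<in>K. ball f (e f))" using Re(1) by auto
  qed auto
  define S where "S = Max (insert 1 (R ` C))"
  have S: "S \<ge> 1" "\<And>f. f \<in> C \<Longrightarrow> R f \<le> S"
    using C by (auto simp: S_def)
  show thesis
  proof (rule that[OF S(1)])
    fix f and z :: complex assume "f \<in> K" "norm z \<ge> S"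
    then obtain g where "g \<in> C" "dist g f < e g" using C by auto
    then show "norm (the_fin (app_pm f (Fin z))) \<ge> 2 * norm z"
      using Re(2)[of g f z] S(2)[of g] \<open>norm z \<ge> S\<close> by simp
  qed
qed

section \<open>Random iteration\<close>

text \<open>The complement of the support is covered by null sets from a countable base, hence is
  null.\<close>

lemma AE_topological_support:
  fixes M :: "'a::second_countable_topology measure"
  assumes sets: "sets M = sets borel"
  shows "AE x in M. x \<in> topological_support M"
proof -
  obtain B :: "'a set set" where B: "countable B" "topological_basis B"
    using ex_countable_basis by blast
  define N where "N = \<Union>{b \<in> B. emeasure M b = 0}"
  have "b \<in> sets M" if "b \<in> B" for b
    using topological_basis_open[OF B(2) that] sets by simp
  then have "N \<in> null_sets M"
    unfolding N_def using B(1)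
    by (intro null_sets_UN'[of "{b \<in> B. emeasure M b = 0}" "\<lambda>b. b", simplified])
      (auto simp: null_setsI)
  moreover have "{x \<in> space M. \<not> x \<in> topological_support M} \<subseteq> N"
  proof
    fix x assume "x \<in> {x \<in> space M. \<not> x \<in> topological_support M}"
    then obtain U where U: "open U" "x \<in> U" "emeasure M U = 0"
      unfolding topological_support_def by auto
    obtain b where b: "b \<in> B" "x \<in> b" "b \<subseteq> U"
      using topological_basisE[OF B(2) U(1,2)] by blast
    have "emeasure M b \<le> emeasure M U"
      using b U sets by (intro emeasure_mono) auto
    then show "x \<in> N" using U b by (auto simp: N_def)
  qed
  ultimately show ?thesis by (rule AE_I')
qed

lemma orbit_cong: "(\<And>i. i < n \<Longrightarrow> \<gamma> i = \<delta> i) \<Longrightarrow> orbit \<gamma> z n = orbit \<delta> z n"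
  by (induction n) auto

lemma orbit_add: "orbit \<gamma> z (n + k) = orbit (\<lambda>i. \<gamma> (i + n)) (orbit \<gamma> z n) k"
  by (induction k) (auto simp: add.commute)

text \<open>Matches the decomposition of a random sequence into its first entry and the rest;
  conditioning on the first step rests on it.\<close>

lemma orbit_Suc_case_nat: "orbit (case_nat f \<gamma>) z (Suc n) = orbit \<gamma> (app_pm f z) n"
  by (induction n) auto

lemma continuous_on_orbit: "continuous_on UNIV (\<lambda>z. orbit \<gamma> z n)"
proof (induction n)
  case (Suc n)
  then show ?case
    using continuous_on_compose2[OF continuous_on_app_pm[of UNIV "\<gamma> n"]] by auto
qed (simp add: continuous_on_id)

lemma sphere_outside_subset_ball:
  assumes "e > 0" obtains r where "r > 0" "\<And>x. x \<in> sphere_outside r \<Longrightarrow> dist x Infty < e"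
  using open_Infty_contains_sphere_outside[of "ball Infty e"] assms
  by (metis centre_in_ball dist_commute mem_ball open_ball subsetD)

text \<open>Turns convergence into countably many conditions, so that escaping is a measurable
  event.\<close>

lemma LIMSEQ_iff_inverse_Suc:
  "X \<longlonglongrightarrow> L \<longleftrightarrow> (\<forall>k. \<exists>N. \<forall>n\<ge>N. dist (X n) L < inverse (real (Suc k)))"
  for L :: "'a::metric_space"
proof
  assume R: "\<forall>k. \<exists>N. \<forall>n\<ge>N. dist (X n) L < inverse (real (Suc k))"
  show "X \<longlonglongrightarrow> L"
  proof (rule metric_LIMSEQ_I)
    fix e :: real assume "e > 0"
    then obtain k where "inverse (real (Suc k)) < e" using reals_Archimedean by blast
    then show "\<exists>N. \<forall>n\<ge>N. dist (X n) L < e" using R by (meson less_trans)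
  qed
qed (intro allI metric_LIMSEQ_D, simp_all)

lemma open_fatou_set: "open (fatou_set G)"
  unfolding fatou_set_def by (subst open_subopen) blast

locale random_polynomials =
  fixes \<tau> :: "polynomial_map measure"
  assumes tau: "\<tau> \<in> compactly_supported_prob_measures"
begin

abbreviation supp where "supp \<equiv> topological_support \<tau>"
abbreviation G where "G \<equiv> semigroup_of \<tau>"
abbreviation T where "T \<equiv> prob_escape \<tau>"
abbreviation path :: "(nat \<Rightarrow> polynomial_map) \<Rightarrow> bool" where "path \<gamma> \<equiv> \<forall>i. \<gamma> i \<in> supp"

lemma sets_tau: "sets \<tau> = sets borel" and compact_supp: "compact supp"
  and prob_space_tau: "prob_space \<tau>"
  using tau by (auto simp: compactly_supported_prob_measures_def)

lemma finite_measure_tau: "finite_measure \<tau>"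
  by (rule prob_space.finite_measure[OF prob_space_tau])

lemma space_tau [simp]: "space \<tau> = UNIV"
  using sets_eq_imp_space_eq[OF sets_tau] by simp

sublocale prob_space \<tau> by (rule prob_space_tau)

sublocale sequence_space \<tau> ..

lemma space_S [simp]: "space S = UNIV"
  by (simp add: space_PiM)

text \<open>The probability space contains all sequences of polynomial maps; this is the licence to
  argue only about sequences in the support.\<close>

lemma AE_path: "AE \<gamma> in S. path \<gamma>"
  unfolding AE_all_countable
proof
  fix i show "AE \<gamma> in S. \<gamma> i \<in> supp"
    by (rule AE_PiM_component) (use AE_topological_support[OF sets_tau] prob_space_tau in auto)
qed

lemma supp_nonempty: "supp \<noteq> {}"
proof
  assume "supp = {}"
  then have "AE x in \<tau>. False" using AE_topological_support[OF sets_tau] by simp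
  then show False by simp
qed

lemma measurable_orbit [measurable]: "(\<lambda>\<gamma>. orbit \<gamma> z n) \<in> borel_measurable S"
proof (induction n)
  case (Suc n)
  have "(\<lambda>\<gamma>. \<gamma> n) \<in> borel_measurable S"
    using measurable_component_singleton[of n UNIV "\<lambda>_. \<tau>"] measurable_cong_sets[OF refl sets_tau]
    by blast
  then show ?case
    using borel_measurable_continuous_Pair[OF _ Suc.IH continuous_on_app_pm_pair] by simp
qed simp

lemma escape_event_sets: "{\<gamma>. orbit \<gamma> z \<longlonglongrightarrow> Infty} \<in> sets S"
proof -
  have "{\<gamma> \<in> space S. \<forall>k. \<exists>N. \<forall>n\<ge>N. dist (orbit \<gamma> z n) Infty < inverse (real (Suc k))} \<in> sets S"
    by measurable
  then show ?thesis by (simp add: LIMSEQ_iff_inverse_Suc)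
qed

lemma T_bounds: "0 \<le> T z" "T z \<le> 1"
  unfolding prob_escape_def by (simp_all add: P.prob_le_1)

lemma ennreal_T: "ennreal (T z) = emeasure S {\<gamma>. orbit \<gamma> z \<longlonglongrightarrow> Infty}"
  unfolding prob_escape_def by (simp add: P.emeasure_eq_measure)

section \<open>One-step decomposition of the escape probability\<close>

lemma case_nat_measurable: "(\<lambda>(f, \<gamma>). case_nat f \<gamma>) \<in> \<tau> \<Otimes>\<^sub>M S \<rightarrow>\<^sub>M S"
  by measurable

text \<open>Dropping the first map does not affect escape, and the sequence measure is the law of a
  first map followed by an independent sequence. Measurability in \<open>f\<close> comes from
  sections of a product set, since no regularity of \<open>T\<close> is available yet.\<close>

lemma T_eq_nn_integral:
  "(\<lambda>f. ennreal (T (app_pm f z))) \<in> borel_measurable \<tau>"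
  "ennreal (T z) = (\<integral>\<^sup>+ f. ennreal (T (app_pm f z)) \<partial>\<tau>)"
proof -
  let ?E = "\<lambda>z. {\<gamma>. orbit \<gamma> z \<longlonglongrightarrow> Infty}"
  define A where "A = (\<lambda>(f, \<gamma>). case_nat f \<gamma>) -` ?E z \<inter> space (\<tau> \<Otimes>\<^sub>M S)"
  have A: "A \<in> sets (\<tau> \<Otimes>\<^sub>M S)"
    unfolding A_def by (rule measurable_sets[OF case_nat_measurable escape_event_sets])
  have slice: "Pair f -` A = ?E (app_pm f z)" for f
  proof -
    have "(orbit (case_nat f \<gamma>) z \<longlonglongrightarrow> Infty) \<longleftrightarrow> (orbit \<gamma> (app_pm f z) \<longlonglongrightarrow> Infty)" for \<gamma>
      using filterlim_sequentially_Suc[of "orbit (case_nat f \<gamma>) z" "nhds Infty"]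
      unfolding orbit_Suc_case_nat by blast
    then show ?thesis by (auto simp: A_def space_pair_measure)
  qed
  have "(\<lambda>f. emeasure S (Pair f -` A)) \<in> borel_measurable \<tau>"
    by (rule P.measurable_emeasure_Pair[OF A])
  then show "(\<lambda>f. ennreal (T (app_pm f z))) \<in> borel_measurable \<tau>"
    by (simp only: slice ennreal_T)
  have "ennreal (T z) = emeasure (distr (\<tau> \<Otimes>\<^sub>M S) S (\<lambda>(f, \<gamma>). case_nat f \<gamma>)) (?E z)"
    by (simp only: PiM_iter ennreal_T)
  also have "\<dots> = emeasure (\<tau> \<Otimes>\<^sub>M S) A"
    unfolding A_def by (rule emeasure_distr[OF case_nat_measurable escape_event_sets])
  also have "\<dots> = (\<integral>\<^sup>+ f. emeasure S (Pair f -` A) \<partial>\<tau>)"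
    by (rule P.emeasure_pair_measure_alt[OF A])
  finally show "ennreal (T z) = (\<integral>\<^sup>+ f. ennreal (T (app_pm f z)) \<partial>\<tau>)"
    by (simp only: slice ennreal_T)
qed

lemma integrable_T: "integrable \<tau> (\<lambda>f. T (app_pm f z))"
proof (rule finite_measure.integrable_const_bound[OF finite_measure_tau, where B = 1])
  have "(\<lambda>f. enn2real (ennreal (T (app_pm f z)))) \<in> borel_measurable \<tau>"
    using T_eq_nn_integral(1) by measurable
  then show "(\<lambda>f. T (app_pm f z)) \<in> borel_measurable \<tau>"
    by (simp add: T_bounds)
qed (simp add: T_bounds)

lemma T_eq_integral: "T z = (\<integral>f. T (app_pm f z) \<partial>\<tau>)"
proof -
  have "(\<integral>\<^sup>+ f. ennreal (T (app_pm f z)) \<partial>\<tau>) = ennreal (\<integral>f. T (app_pm f z) \<partial>\<tau>)"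
    by (rule nn_integral_eq_integral[OF integrable_T]) (simp add: T_bounds)
  then have "ennreal (T z) = ennreal (\<integral>f. T (app_pm f z) \<partial>\<tau>)"
    by (simp only: T_eq_nn_integral(2)[of z])
  moreover have "0 \<le> (\<integral>f. T (app_pm f z) \<partial>\<tau>)"
    by (intro integral_nonneg_AE) (simp add: T_bounds)
  ultimately show ?thesis by (simp add: T_bounds del: ennreal_T)
qed

section \<open>Absorption near infinity\<close>

definition R where
  "R = (SOME R. R \<ge> 1 \<and> (\<forall>f\<in>supp. \<forall>z. norm z \<ge> R \<longrightarrow> norm (the_fin (app_pm f (Fin z))) \<ge> 2 * norm z))"

lemma R_ge_1: "R \<ge> 1"
  and escape_step: "f \<in> supp \<Longrightarrow> norm z \<ge> R \<Longrightarrow> norm (the_fin (app_pm f (Fin z))) \<ge> 2 * norm z"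
proof -
  have "\<exists>R. R \<ge> 1 \<and> (\<forall>f\<in>supp. \<forall>z. norm z \<ge> R \<longrightarrow> norm (the_fin (app_pm f (Fin z))) \<ge> 2 * norm z)"
    using escape_radius_compact[OF compact_supp] by metis
  from someI_ex[OF this, folded R_def]
  show "R \<ge> 1"
    and "f \<in> supp \<Longrightarrow> norm z \<ge> R \<Longrightarrow> norm (the_fin (app_pm f (Fin z))) \<ge> 2 * norm z"
    by auto
qed

lemma orbit_growth:
  assumes "path \<gamma>" "x \<in> sphere_outside R"
  shows "orbit \<gamma> x n \<in> sphere_outside (2 ^ n * R)"
proof (induction n)
  case (Suc n)
  show ?case
  proof (cases "orbit \<gamma> x n")
    case (Fin z)
    obtain w where w: "app_pm (\<gamma> n) (Fin z) = Fin w" by (rule app_pm_Fin)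
    have z: "norm z > 2 ^ n * R" using Suc Fin by simp
    moreover have "R \<le> 2 ^ n * R" using R_ge_1 by simp
    ultimately have "norm w \<ge> 2 * norm z"
      using escape_step[of "\<gamma> n" z] assms(1) w by simp
    then show ?thesis using z Fin w by simp
  qed simp
qed (use assms in simp)

text \<open>The moduli at least double at each step, so \<open>N\<close> depends only on the target
  neighbourhood and is uniform in the path and in the starting point.\<close>

lemma eventually_near_Infty:
  assumes "e > 0"
  obtains N where "\<And>\<gamma> x n. path \<gamma> \<Longrightarrow> x \<in> sphere_outside R \<Longrightarrow> n \<ge> N \<Longrightarrow> dist (orbit \<gamma> x n) Infty < e"
proof -
  obtain r where r: "r > 0" "\<And>x. x \<in> sphere_outside r \<Longrightarrow> dist x Infty < e"
    using sphere_outside_subset_ball[OF assms] by blast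
  obtain N where N: "r < 2 ^ N" using real_arch_pow[of 2 r] by auto
  show thesis
  proof (rule that)
    fix \<gamma> x n assume *: "path \<gamma>" "x \<in> sphere_outside R" "N \<le> n"
    have "r \<le> 2 ^ n * 1" using less_le_trans[OF N power_increasing[OF *(3), of "2::real"]] by simp
    also have "\<dots> \<le> 2 ^ n * R" using R_ge_1 by (intro mult_left_mono) auto
    finally have "sphere_outside (2 ^ n * R) \<subseteq> sphere_outside r" by (auto simp: sphere_outside_def)
    then show "dist (orbit \<gamma> x n) Infty < e" using orbit_growth[OF *(1,2)] r(2) by blast
  qed
qed

lemma orbit_tendsto_Infty:
  assumes "path \<gamma>" "orbit \<gamma> x n \<in> sphere_outside R"
  shows "orbit \<gamma> x \<longlonglongrightarrow> Infty"
proof -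
  have "orbit (\<lambda>i. \<gamma> (i + n)) (orbit \<gamma> x n) \<longlonglongrightarrow> Infty"
  proof (rule metric_LIMSEQ_I)
    fix e :: real assume "e > 0"
    then obtain N where N: "\<And>\<gamma> x n. path \<gamma> \<Longrightarrow> x \<in> sphere_outside R \<Longrightarrow> n \<ge> N \<Longrightarrow> dist (orbit \<gamma> x n) Infty < e"
      using eventually_near_Infty by blast
    have "dist (orbit (\<lambda>i. \<gamma> (i + n)) (orbit \<gamma> x n) k) Infty < e" if "k \<ge> N" for k
      by (rule N) (use assms that in auto)
    then show "\<exists>N. \<forall>k\<ge>N. dist (orbit (\<lambda>i. \<gamma> (i + n)) (orbit \<gamma> x n) k) Infty < e"
      by blast
  qed
  then have "(\<lambda>k. orbit \<gamma> x (k + n)) \<longlonglongrightarrow> Infty"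
    by (simp only: orbit_add add.commute[of _ n])
  then show ?thesis by (rule LIMSEQ_offset)
qed

lemma T_outside: "x \<in> sphere_outside R \<Longrightarrow> T x = 1"
proof -
  assume x: "x \<in> sphere_outside R"
  have "AE \<gamma> in S. orbit \<gamma> x \<longlonglongrightarrow> Infty"
    using AE_path by eventually_elim (use orbit_tendsto_Infty[of _ x 0] x in auto)
  then show ?thesis
    unfolding prob_escape_def
    using P.prob_Collect_eq_1[of "\<lambda>\<gamma>. orbit \<gamma> x \<longlonglongrightarrow> Infty"] escape_event_sets by simp
qed

section \<open>The semigroup as the set of nonempty words\<close>

lemma orbit_in_G: "path \<gamma> \<Longrightarrow> (\<lambda>z. orbit \<gamma> z (Suc n)) \<in> G"
proof (induction n)
  case 0
  then have "app_pm (\<gamma> 0) \<in> G"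
    unfolding semigroup_of_def by (intro generated_semigroup.generator) auto
  then show ?case by simp
next
  case (Suc n)
  have "app_pm (\<gamma> (Suc n)) \<in> G"
    unfolding semigroup_of_def using Suc by (intro generated_semigroup.generator) auto
  from generated_semigroup.compose[OF this[unfolded semigroup_of_def] Suc.IH[OF Suc.prems, unfolded semigroup_of_def]]
  show ?case by (simp add: o_def semigroup_of_def)
qed

text \<open>With \<open>orbit_in_G\<close> this identifies \<open>G\<close> with the maps of finite
  nonempty words in the support. The index is \<open>Suc n\<close> because the empty word, the
  identity, is not adjoined to the semigroup.\<close>

lemma G_orbitE:
  assumes "g \<in> G"
  obtains \<gamma> n where "path \<gamma>" "g = (\<lambda>z. orbit \<gamma> z (Suc n))"
proof -
  have "g \<in> generated_semigroup (app_pm ` supp)" using assms by (simp add: semigroup_of_def)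
  then have "\<exists>\<gamma> n. path \<gamma> \<and> g = (\<lambda>z. orbit \<gamma> z (Suc n))"
  proof induction
    case (generator g)
    then obtain f where "f \<in> supp" "g = app_pm f" by auto
    then show ?case by (intro exI[of _ "\<lambda>_. f"] exI[of _ 0]) auto
  next
    case (compose g h)
    then obtain \<gamma> n \<delta> m where *: "path \<gamma>" "g = (\<lambda>z. orbit \<gamma> z (Suc n))"
      "path \<delta>" "h = (\<lambda>z. orbit \<delta> z (Suc m))" by blast
    \<comment> \<open>An orbit applies entry 0 first, so the word of the inner map \<open>h\<close>
      precedes that of \<open>g\<close>.\<close>
    define \<eta> where "\<eta> i = (if i < Suc m then \<delta> i else \<gamma> (i - Suc m))" for i
    have "orbit \<eta> z (Suc (m + Suc n)) = (g \<circ> h) z" for z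
    proof -
      have "orbit \<eta> z (Suc m + Suc n) = orbit (\<lambda>i. \<eta> (i + Suc m)) (orbit \<eta> z (Suc m)) (Suc n)"
        by (rule orbit_add)
      also have "orbit \<eta> z (Suc m) = h z"
        unfolding *(4) by (rule orbit_cong) (simp add: \<eta>_def)
      also have "orbit (\<lambda>i. \<eta> (i + Suc m)) (h z) (Suc n) = g (h z)"
        unfolding *(2) by (rule orbit_cong) (simp add: \<eta>_def)
      finally show ?thesis by simp
    qed
    then have "g \<circ> h = (\<lambda>z. orbit \<eta> z (Suc (m + Suc n)))" by (intro ext) (rule sym)
    moreover have "path \<eta>" using *(1,3) by (simp add: \<eta>_def)
    ultimately show ?case by blast
  qed
  then show thesis using that by blast
qed

lemma G_compose: "g \<in> G \<Longrightarrow> h \<in> G \<Longrightarrow> g \<circ> h \<in> G"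
  unfolding semigroup_of_def by (rule generated_semigroup.compose)

lemma continuous_on_G:
  assumes "g \<in> G" shows "continuous_on UNIV g"
proof -
  obtain \<gamma> n where "g = (\<lambda>z. orbit \<gamma> z (Suc n))" using G_orbitE[OF assms] by blast
  then show ?thesis by (simp only: continuous_on_orbit)
qed

lemma orbits_uniformly_equicontinuous:
  "e > 0 \<Longrightarrow> \<exists>d>0. \<forall>\<gamma> x y. path \<gamma> \<longrightarrow> dist x y < d \<longrightarrow> dist (orbit \<gamma> x n) (orbit \<gamma> y n) < e"
proof (induction n arbitrary: e)
  case (Suc n)
  obtain d where d: "d > 0"
    "\<And>f x y. f \<in> supp \<Longrightarrow> dist x y < d \<Longrightarrow> dist (app_pm f x) (app_pm f y) < e"
    using compact_imp_uniformly_equicontinuous[OF compact_supp Suc.prems] by blast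
  obtain d' where "d' > 0"
    "\<And>\<gamma> x y. path \<gamma> \<Longrightarrow> dist x y < d' \<Longrightarrow> dist (orbit \<gamma> x n) (orbit \<gamma> y n) < d"
    using Suc.IH[OF d(1)] by blast
  then show ?case using d(2) by (intro exI[of _ d']) auto
qed auto

lemma orbits_uniformly_equicontinuous_below:
  "e > 0 \<Longrightarrow> \<exists>d>0. \<forall>\<gamma> x y. \<forall>n<N. path \<gamma> \<longrightarrow> dist x y < d \<longrightarrow> dist (orbit \<gamma> x n) (orbit \<gamma> y n) < e"
proof (induction N)
  case 0
  then show ?case by (intro exI[of _ 1]) auto
next
  case (Suc N)
  then obtain d1 where d1: "d1 > 0"
    "\<And>\<gamma> x y n. n < N \<Longrightarrow> path \<gamma> \<Longrightarrow> dist x y < d1 \<Longrightarrow> dist (orbit \<gamma> x n) (orbit \<gamma> y n) < e"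
    by blast
  obtain d2 where d2: "d2 > 0"
    "\<And>\<gamma> x y. path \<gamma> \<Longrightarrow> dist x y < d2 \<Longrightarrow> dist (orbit \<gamma> x N) (orbit \<gamma> y N) < e"
    using orbits_uniformly_equicontinuous[OF Suc.prems] by blast
  show ?case
    using d1 d2 by (intro exI[of _ "min d1 d2"]) (auto simp: less_Suc_eq)
qed

text \<open>Long words send points of \<^term>\<open>sphere_outside R\<close> close to infinity, and the words of bounded
  length form an equicontinuous family because the support is compact.\<close>

lemma Infty_in_fatou_set: "Infty \<in> fatou_set G"
proof -
  have "equicontinuous_on (sphere_outside R) G"
    unfolding equicontinuous_on_def
  proof (intro ballI allI impI)
    fix x and e :: real assume x: "x \<in> sphere_outside R" and e: "e > 0"
    obtain N where N: "\<And>\<gamma> x n. path \<gamma> \<Longrightarrow> x \<in> sphere_outside R \<Longrightarrow> n \<ge> N \<Longrightarrow>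
        dist (orbit \<gamma> x n) Infty < e / 2"
      using eventually_near_Infty[of "e / 2"] e by (metis half_gt_zero)
    obtain d where d: "d > 0"
      "\<And>\<gamma> x y n. n < N \<Longrightarrow> path \<gamma> \<Longrightarrow> dist x y < d \<Longrightarrow> dist (orbit \<gamma> x n) (orbit \<gamma> y n) < e"
      using orbits_uniformly_equicontinuous_below[OF e, of N] by blast
    have "dist (g x) (g y) < e" if y: "y \<in> sphere_outside R" "dist x y < d" and g: "g \<in> G" for y g
    proof -
      obtain \<gamma> n where \<gamma>: "path \<gamma>" "g = (\<lambda>z. orbit \<gamma> z (Suc n))" using G_orbitE[OF g] by blast
      show ?thesis
      proof (cases "Suc n < N")
        case True
        then show ?thesis using d(2)[OF True \<gamma>(1) y(2)] \<gamma>(2) by simp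
      next
        case False
        then have "dist (g x) Infty < e / 2" "dist (g y) Infty < e / 2"
          using N[OF \<gamma>(1), of _ "Suc n"] x y(1) unfolding \<gamma>(2) by auto
        then show ?thesis using dist_triangle2[of "g x" "g y" Infty] by simp
      qed
    qed
    then show "\<exists>d>0. \<forall>y\<in>sphere_outside R. dist x y < d \<longrightarrow> (\<forall>g\<in>G. dist (g x) (g y) < e)"
      using d(1) by blast
  qed
  moreover have "open (sphere_outside R)" using R_ge_1 by (intro open_sphere_outside) simp
  ultimately show ?thesis
    unfolding fatou_set_def using Infty_in_sphere_outside by blast
qed

text \<open>If one orbit comes within \<open>e / 2\<close> of infinity, equicontinuity brings the
  neighbouring orbit within \<open>e\<close> at the same time, and it is absorbed. So for every path
  in the support the two points escape together or not at all.\<close>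

lemma T_locally_constant:
  assumes "z \<in> fatou_set G"
  obtains U where "open U" "z \<in> U" "\<And>y. y \<in> U \<Longrightarrow> T y = T z"
proof -
  obtain V where V: "open V" "z \<in> V" "equicontinuous_on V G"
    using assms by (auto simp: fatou_set_def)
  \<comment> \<open>With this \<open>e\<close> the ball about \<open>Infty\<close> is exactly
    \<open>sphere_outside R\<close>.\<close>
  define e where "e = dist (Fin (of_real R)) Infty"
  have out: "x \<in> sphere_outside R" if "dist x Infty < e" for x
    using that R_ge_1 by (simp add: e_def sphere_outside_eq_ball dist_commute)
  have e: "e > 0" by (simp add: e_def)
  obtain d where d: "d > 0"
    "\<And>y g. y \<in> V \<Longrightarrow> dist z y < d \<Longrightarrow> g \<in> G \<Longrightarrow> dist (g z) (g y) < e / 2"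
    using V(2,3) e unfolding equicontinuous_on_def by (meson half_gt_zero)
  have transfer: "orbit \<gamma> y \<longlonglongrightarrow> Infty"
    if \<gamma>: "path \<gamma>" and lim: "orbit \<gamma> x \<longlonglongrightarrow> Infty"
      and close: "\<And>g. g \<in> G \<Longrightarrow> dist (g x) (g y) < e / 2" for \<gamma> x y
  proof -
    have "\<forall>\<^sub>F n in sequentially. dist (orbit \<gamma> x (Suc n)) Infty < e / 2"
      by (rule tendstoD[OF LIMSEQ_Suc[OF lim]]) (use e in simp)
    then obtain n where n: "dist (orbit \<gamma> x (Suc n)) Infty < e / 2"
      using eventually_happens'[OF sequentially_bot] by blast
    moreover have "dist (orbit \<gamma> x (Suc n)) (orbit \<gamma> y (Suc n)) < e / 2"
      by (rule close[OF orbit_in_G[OF \<gamma>]])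
    ultimately have "dist (orbit \<gamma> y (Suc n)) Infty < e"
      using dist_triangle3[of "orbit \<gamma> y (Suc n)" Infty "orbit \<gamma> x (Suc n)"] by linarith
    then show ?thesis using out orbit_tendsto_Infty[OF \<gamma>] by blast
  qed
  show thesis
  proof (rule that[of "V \<inter> ball z d"])
    fix y assume y: "y \<in> V \<inter> ball z d"
    then have close: "\<And>g. g \<in> G \<Longrightarrow> dist (g z) (g y) < e / 2" using d by simp
    then have close': "\<And>g. g \<in> G \<Longrightarrow> dist (g y) (g z) < e / 2" by (simp add: dist_commute)
    have "AE \<gamma> in S. (orbit \<gamma> y \<longlonglongrightarrow> Infty) \<longleftrightarrow> (orbit \<gamma> z \<longlonglongrightarrow> Infty)"
      using AE_path by eventually_elim (use transfer close close' in blast)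
    then show "T y = T z"
      unfolding prob_escape_def
      by (intro P.finite_measure_eq_AE escape_event_sets) auto
  qed (use V d in auto)
qed

end

section \<open>Continuity of the escape probability\<close>

context random_polynomials
begin

text \<open>The oscillation of \<^term>\<open>T\<close> is averaged by one step of the random walk, so the set where it is
  maximal is forward invariant; being disjoint from the Fatou set, it lies in the kernel Julia set.\<close>

lemma continuous_on_T:
  assumes ker: "kernel_julia_set G = {}"
  shows "continuous_on UNIV T"
proof -
  have T1: "\<bar>T x - T y\<bar> \<le> 1" for x y
    using T_bounds[of x] T_bounds[of y] by linarith
  \<comment> \<open>The infimum \<open>m\<close> of \<open>C\<close> is the limit of the global
    modulus of continuity as the scale tends to 0; continuity of \<open>T\<close> amounts to
    \<open>m \<le> 0\<close>.\<close>
  define C where "C = {c. \<exists>d>0. \<forall>x y. dist x y < d \<longrightarrow> \<bar>T x - T y\<bar> \<le> c}"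
  have C1: "1 \<in> C" using T1 by (auto simp: C_def intro!: exI[of _ 1])
  have C0: "0 \<le> c" if "c \<in> C" for c
  proof -
    have "\<exists>d>0. \<forall>x y. dist x y < d \<longrightarrow> \<bar>T x - T y\<bar> \<le> c" using that by (simp add: C_def)
    then obtain d where "d > 0" and d: "\<forall>x y. dist x y < d \<longrightarrow> \<bar>T x - T y\<bar> \<le> c" by blast
    with d[rule_format, of Infty Infty] show ?thesis by simp
  qed
  then have bdd: "bdd_below C" by (meson bdd_belowI)
  define m where "m = Inf C"
  have close: "\<exists>d>0. \<forall>x y. dist x y < d \<longrightarrow> \<bar>T x - T y\<bar> \<le> c" if c: "c > m" for c
  proof -
    obtain c' where c': "c' \<in> C" "c' < c"
      using cInf_lessD[of C c] C1 c unfolding m_def by blast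
    obtain d where "d > 0" "\<And>x y. dist x y < d \<Longrightarrow> \<bar>T x - T y\<bar> \<le> c'"
      using c'(1) by (auto simp: C_def)
    then show ?thesis using c'(2) by (meson less_imp_le order_trans)
  qed
  have apart: "\<exists>x y. dist x y < d \<and> \<bar>T x - T y\<bar> > c" if "c < m" "d > 0" for c d
  proof (rule ccontr)
    assume "\<not> ?thesis"
    then have "\<forall>x y. dist x y < d \<longrightarrow> \<bar>T x - T y\<bar> \<le> c" by (meson not_less)
    then have "c \<in> C" using that unfolding C_def by blast
    then show False using cInf_lower[OF _ bdd] that unfolding m_def by fastforce
  qed
  have "m \<le> 0"
  proof (rule ccontr)
    assume "\<not> m \<le> 0"
    then have m: "m > 0" by simp
    \<comment> \<open>The points at which oscillation \<open>m\<close> is approached at every scale.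
      The strict \<open>c < m\<close> is there because the infimum need not be attained.\<close>
    define E where "E = {z. \<forall>c<m. \<forall>d>0. \<exists>x y. dist x z < d \<and> dist y z < d \<and> \<bar>T x - T y\<bar> > c}"
    have "E \<noteq> {}"
    proof -
      have "\<exists>x y. dist x y < inverse (real (Suc n)) \<and> \<bar>T x - T y\<bar> > m - inverse (real (Suc n))" for n
        by (rule apart) simp_all
      then obtain X Y where XY: "\<And>n. dist (X n) (Y n) < inverse (real (Suc n))"
        "\<And>n. \<bar>T (X n) - T (Y n)\<bar> > m - inverse (real (Suc n))" by metis
      \<comment> \<open>The pairs \<open>X n\<close>, \<open>Y n\<close> nearly realise the
        oscillation \<open>m\<close> at shrinking scales; an accumulation point of the
        \<open>X n\<close> also attracts the matching \<open>Y n\<close> and lies in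
        \<open>E\<close>.\<close>
      obtain z r where r: "strict_mono r" and lim: "(X \<circ> r) \<longlonglongrightarrow> z"
        using compact_UNIV_sphere[unfolded compact_eq_seq_compact_metric seq_compact_def] by blast
      have "z \<in> E"
        unfolding E_def
      proof (intro CollectI allI impI)
        fix c d :: real assume "c < m" "d > 0"
        obtain n0 where n0: "\<And>n. n \<ge> n0 \<Longrightarrow> dist (X (r n)) z < d / 2"
          using metric_LIMSEQ_D[OF lim, of "d / 2"] \<open>d > 0\<close> by auto
        obtain k where k: "inverse (real (Suc k)) < min (d / 2) (m - c)"
          using reals_Archimedean[of "min (d / 2) (m - c)"] \<open>d > 0\<close> \<open>c < m\<close> by auto
        define n where "n = max n0 k"
        have "k \<le> r n" using seq_suble[OF r, of n] by (simp add: n_def)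
        then have "inverse (real (Suc (r n))) \<le> inverse (real (Suc k))"
          by (intro le_imp_inverse_le) auto
        then have small: "inverse (real (Suc (r n))) < d / 2" "inverse (real (Suc (r n))) < m - c"
          using k by linarith+
        have x: "dist (X (r n)) z < d / 2" using n0 by (simp add: n_def)
        moreover have "dist (Y (r n)) z < d"
          using XY(1)[of "r n"] small x dist_triangle3[of "Y (r n)" z "X (r n)"] by linarith
        moreover have "\<bar>T (X (r n)) - T (Y (r n))\<bar> > c"
          using XY(2)[of "r n"] small by linarith
        ultimately show "\<exists>x y. dist x z < d \<and> dist y z < d \<and> \<bar>T x - T y\<bar> > c"
          using \<open>d > 0\<close> by (intro exI[of _ "X (r n)"] exI[of _ "Y (r n)"]) auto
      qed
      then show ?thesis by blast
    qed
    have E_julia: "z \<in> julia_set G" if z: "z \<in> E" for z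
    proof (rule ccontr)
      assume "z \<notin> julia_set G"
      then have "z \<in> fatou_set G" by (simp add: julia_set_def)
      then obtain U where U: "open U" "z \<in> U" "\<And>y. y \<in> U \<Longrightarrow> T y = T z"
        using T_locally_constant by blast
      obtain d where d: "d > 0" "ball z d \<subseteq> U" using U open_contains_ball by blast
      obtain x y where "dist x z < d" "dist y z < d" "\<bar>T x - T y\<bar> > 0"
        using z m d(1) unfolding E_def by blast
      moreover from this have "x \<in> U" "y \<in> U" using d(2) by (auto simp: dist_commute)
      ultimately show False using U(3)[of x] U(3)[of y] by simp
    qed
    have E_step: "app_pm f z \<in> E" if z: "z \<in> E" and f: "f \<in> supp" for f z
    proof (rule ccontr)
      assume "app_pm f z \<notin> E"
      then obtain c d where c: "c < m" and d: "d > 0"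
        and "\<not> (\<exists>x y. dist x (app_pm f z) < d \<and> dist y (app_pm f z) < d \<and> \<bar>T x - T y\<bar> > c)"
        unfolding E_def by blast
      then have cd: "\<bar>T x - T y\<bar> \<le> c"
        if "dist x (app_pm f z) < d" "dist y (app_pm f z) < d" for x y
        using that by (meson not_less)
      have "isCont (\<lambda>x. app_pm (fst x) (snd x)) (f, z)"
        using continuous_on_app_pm_pair[of UNIV] by (auto simp: continuous_on_eq_continuous_at)
      then obtain s where s: "s > 0"
        "\<And>x. dist x (f, z) < s \<Longrightarrow> dist (app_pm (fst x) (snd x)) (app_pm f z) < d"
        using d unfolding continuous_at_eps_delta by (metis fst_conv snd_conv)
      define W where "W = ball f (s / 2)"
      have W: "dist (app_pm g x) (app_pm f z) < d" if "g \<in> W" "dist x z < s / 2" for g x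
      proof -
        have "dist (g, x) (f, z) \<le> dist g f + dist x z"
          unfolding dist_Pair_Pair by (rule sqrt_sum_squares_le_sum) simp_all
        then show ?thesis using s(2)[of "(g, x)"] that by (simp add: W_def dist_commute)
      qed
      have W_sets: "W \<in> sets \<tau>" using sets_tau by (simp add: W_def)
      define p where "p = measure \<tau> W"
      have "emeasure \<tau> W > 0"
        using f s(1) by (auto simp: topological_support_def W_def)
      then have p: "p > 0"
        by (simp add: p_def finite_measure.emeasure_eq_measure[OF finite_measure_tau])
      have p1: "p \<le> 1" unfolding p_def by (rule prob_space.prob_le_1[OF prob_space_tau])
      \<comment> \<open>Maps in \<open>W\<close> save at least \<open>(m - c) * p = 2 * e\<close>
        against \<open>m\<close> on average, while the uniform bound for the rest is only
        \<open>m + e\<close>. Half the saving pays for this excess, and the other half contradicts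
        \<open>z \<in> E\<close>.\<close>
      define e where "e = (m - c) * p / 2"
      have e: "e > 0" using c p by (simp add: e_def)
      obtain d1 where d1: "d1 > 0" "\<And>x y. dist x y < d1 \<Longrightarrow> \<bar>T x - T y\<bar> \<le> m + e"
        using close[of "m + e"] e by auto
      obtain d2 where d2: "d2 > 0"
        "\<And>f x y. f \<in> supp \<Longrightarrow> dist x y < d2 \<Longrightarrow> dist (app_pm f x) (app_pm f y) < d1"
        using compact_imp_uniformly_equicontinuous[OF compact_supp d1(1)] by blast
      define \<eta> where "\<eta> = min (s / 2) (d2 / 2)"
      have "\<bar>T x - T y\<bar> \<le> m - e" if x: "dist x z < \<eta>" and y: "dist y z < \<eta>" for x y
      proof -
        have xy: "dist x y < d2"
          using x y dist_triangle2[of x y z] by (simp add: \<eta>_def)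
        let ?b = "\<lambda>g. (m + e) - (m + e - c) * indicator W g"
        have bound: "AE g in \<tau>. \<bar>T (app_pm g x) - T (app_pm g y)\<bar> \<le> ?b g"
          using AE_topological_support[OF sets_tau]
        proof eventually_elim
          fix g assume g: "g \<in> supp"
          show "\<bar>T (app_pm g x) - T (app_pm g y)\<bar> \<le> ?b g"
          proof (cases "g \<in> W")
            case True
            then show ?thesis using cd W x y by (simp add: \<eta>_def)
          next
            case False
            then show ?thesis using d1(2) d2(2)[OF g xy] by simp
          qed
        qed
        have int_W: "integrable \<tau> (\<lambda>g. indicator W g :: real)"
          using W_sets by (intro integrable_real_indicator) (simp_all add: less_top[symmetric] finite_measure_tau finite_measure.emeasure_finite)
        have int_b: "integrable \<tau> ?b"
          using int_W finite_measure.integrable_const[OF finite_measure_tau]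
          by (intro Bochner_Integration.integrable_diff integrable_mult_right) auto
        have int_d: "integrable \<tau> (\<lambda>g. T (app_pm g x) - T (app_pm g y))"
          by (intro Bochner_Integration.integrable_diff integrable_T)
        have "\<bar>T x - T y\<bar> = \<bar>\<integral>g. T (app_pm g x) - T (app_pm g y) \<partial>\<tau>\<bar>"
          by (simp add: T_eq_integral[of x] T_eq_integral[of y] integrable_T
              Bochner_Integration.integral_diff)
        also have "\<dots> \<le> (\<integral>g. \<bar>T (app_pm g x) - T (app_pm g y)\<bar> \<partial>\<tau>)"
          by (rule integral_abs_bound)
        also have "\<dots> \<le> (\<integral>g. ?b g \<partial>\<tau>)"
          by (rule integral_mono_AE[OF integrable_abs[OF int_d] int_b bound])
        also have "\<dots> = (m + e) - (m + e - c) * p"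
          using int_W W_sets finite_measure.integrable_const[OF finite_measure_tau]
          by (subst Bochner_Integration.integral_diff)
            (auto simp: p_def prob_space.prob_space[OF prob_space_tau, simplified])
        also have "\<dots> = m - (m - c) * p + e - e * p" by (simp add: algebra_simps)
        also have "\<dots> = m - e - e * p" by (simp add: e_def)
        finally show ?thesis using mult_pos_pos[OF e p] by linarith
      qed
      moreover have "\<eta> > 0" "m - e < m" using s(1) d2(1) e by (simp_all add: \<eta>_def)
      then have "\<exists>x y. dist x z < \<eta> \<and> dist y z < \<eta> \<and> \<bar>T x - T y\<bar> > m - e"
        using z unfolding E_def by blast
      ultimately show False by (meson not_less)
    qed
    have E_orbit: "orbit \<gamma> z n \<in> E" if "path \<gamma>" "z \<in> E" for \<gamma> z n
      using that by (induction n) (auto intro: E_step)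
    have "g z \<in> E" if "g \<in> G" "z \<in> E" for g z
    proof -
      obtain \<gamma> n where \<gamma>: "path \<gamma>" "g = (\<lambda>z. orbit \<gamma> z (Suc n))" using G_orbitE[OF \<open>g \<in> G\<close>] by blast
      show ?thesis unfolding \<gamma>(2) by (rule E_orbit[OF \<gamma>(1) \<open>z \<in> E\<close>])
    qed
    then have "E \<subseteq> kernel_julia_set G"
      using E_julia unfolding kernel_julia_set_def by blast
    then show False using ker \<open>E \<noteq> {}\<close> by blast
  qed
  show ?thesis
    unfolding continuous_on_iff
  proof (intro ballI allI impI)
    fix x and e :: real assume "e > 0"
    then obtain d where d: "d > 0" "\<And>x y. dist x y < d \<Longrightarrow> \<bar>T x - T y\<bar> \<le> e / 2"
      using close[of "e / 2"] \<open>m \<le> 0\<close> by auto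
    have "dist (T y) (T x) < e" if "dist y x < d" for y
      using d(2)[OF that] \<open>e > 0\<close> by (simp add: dist_real_def)
    then show "\<exists>d>0. \<forall>y\<in>UNIV. dist y x < d \<longrightarrow> dist (T y) (T x) < e" using d(1) by blast
  qed
qed

section \<open>The smallest filled Julia set\<close>

abbreviation K where "K \<equiv> smallest_filled_julia_set G"

text \<open>Once a word has carried the point beyond \<open>R\<close>, iterating any single
  generator makes the orbit unbounded. A bound depending on the point is thus replaced by one
  uniform test, which also shows that \<open>K\<close> is closed.\<close>

lemma K_iff: "z \<in> K \<longleftrightarrow> (\<forall>g\<in>G. g (Fin z) \<notin> sphere_outside R)"
proof
  assume *: "\<forall>g\<in>G. g (Fin z) \<notin> sphere_outside R"
  have "g (Fin z) \<in> Fin ` cball 0 R" if "g \<in> G" for g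
    using * that by (cases "g (Fin z)") (auto simp: not_less)
  then show "z \<in> K"
    unfolding smallest_filled_julia_set_def by (auto intro!: exI[of _ "cball 0 R"])
next
  assume "z \<in> K"
  then obtain B where B: "bounded B" "\<And>g. g \<in> G \<Longrightarrow> g (Fin z) \<in> Fin ` B"
    unfolding smallest_filled_julia_set_def by blast
  obtain b where b: "\<And>w. w \<in> B \<Longrightarrow> norm w \<le> b" using B(1) unfolding bounded_iff by blast
  obtain f where f: "f \<in> supp" using supp_nonempty by blast
  show "\<forall>g\<in>G. g (Fin z) \<notin> sphere_outside R"
  proof (intro ballI notI)
    fix g assume g: "g \<in> G" and out: "g (Fin z) \<in> sphere_outside R"
    obtain n where n: "b < 2 ^ n" using real_arch_pow[of 2 b] by auto
    have "(\<lambda>z. orbit (\<lambda>_. f) z (Suc n)) \<circ> g \<in> G"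
      by (intro G_compose orbit_in_G g) (simp add: f)
    from B(2)[OF this] obtain w where w: "w \<in> B" "orbit (\<lambda>_. f) (g (Fin z)) (Suc n) = Fin w" by auto
    have "orbit (\<lambda>_. f) (g (Fin z)) (Suc n) \<in> sphere_outside (2 ^ Suc n * R)"
      by (intro orbit_growth out) (simp add: f)
    then have "2 ^ Suc n * R < norm w" unfolding w(2) by simp
    moreover have "2 ^ n * 1 \<le> 2 ^ Suc n * R" using R_ge_1 by (intro mult_mono) auto
    ultimately show False using b[OF w(1)] n by linarith
  qed
qed

lemma orbit_not_outside: "z \<in> K \<Longrightarrow> path \<gamma> \<Longrightarrow> orbit \<gamma> (Fin z) (Suc n) \<notin> sphere_outside R"
  using orbit_in_G[of \<gamma> n] K_iff[of z] by (auto dest: bspec)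

text \<open>The test in \<open>K_iff\<close> does not include the point itself, so one generator is
  applied first.\<close>

lemma norm_le_if_in_K: "z \<in> K \<Longrightarrow> norm z \<le> R"
proof (rule ccontr)
  assume z: "z \<in> K" "\<not> norm z \<le> R"
  obtain f where f: "f \<in> supp" using supp_nonempty by blast
  have "orbit (\<lambda>_. f) (Fin z) (Suc 0) \<in> sphere_outside (2 ^ Suc 0 * R)"
    by (intro orbit_growth) (use f z in auto)
  then have "orbit (\<lambda>_. f) (Fin z) (Suc 0) \<in> sphere_outside R"
    using R_ge_1 by (auto simp: sphere_outside_def)
  then show False using orbit_not_outside[OF z(1), of "\<lambda>_. f" 0] f by simp
qed

lemma compact_K: "compact K"
proof -
  have "open (\<Union>g\<in>G. Fin -` (g -` sphere_outside R))"
    using R_ge_1 by (intro open_UN ballI open_vimage_Fin open_vimage continuous_on_G open_sphere_outside) auto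
  moreover have "- K = (\<Union>g\<in>G. Fin -` (g -` sphere_outside R))"
    by (auto simp: K_iff)
  ultimately have "closed K" by (simp add: closed_def)
  moreover have "bounded K" using norm_le_if_in_K by (auto simp: bounded_iff)
  ultimately show ?thesis by (simp add: compact_eq_bounded_closed)
qed

lemma T_eq_0_if_in_K: assumes z: "z \<in> K" shows "T (Fin z) = 0"
proof -
  have "AE \<gamma> in S. \<not> orbit \<gamma> (Fin z) \<longlonglongrightarrow> Infty"
    using AE_path
  proof eventually_elim
    fix \<gamma> assume \<gamma>: "path \<gamma>"
    show "\<not> orbit \<gamma> (Fin z) \<longlonglongrightarrow> Infty"
    proof
      assume "orbit \<gamma> (Fin z) \<longlonglongrightarrow> Infty"
      then have "\<forall>\<^sub>F n in sequentially. orbit \<gamma> (Fin z) (Suc n) \<in> sphere_outside R"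
        using R_ge_1 by (intro topological_tendstoD[OF LIMSEQ_Suc] open_sphere_outside) auto
      then obtain n where "orbit \<gamma> (Fin z) (Suc n) \<in> sphere_outside R"
        using eventually_happens'[OF sequentially_bot] by blast
      then show False using orbit_not_outside[OF z \<gamma>] by blast
    qed
  qed
  then show ?thesis
    unfolding prob_escape_def
    using P.prob_Collect_eq_0[of "\<lambda>\<gamma>. orbit \<gamma> (Fin z) \<longlonglongrightarrow> Infty"] escape_event_sets by simp
qed

text \<open>An empty kernel provides a word \<open>g\<close> moving a point of \<open>K\<close> into
  the Fatou set. All further images of \<open>g (Fin z)\<close> stay bounded, and equicontinuity
  extends this to a neighbourhood; the interior point found is the image \<open>w\<close>.\<close>

lemma interior_K:
  assumes ker: "kernel_julia_set G = {}" and K: "K \<noteq> {}"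
  shows "interior K \<noteq> {}"
proof -
  obtain z where z: "z \<in> K" using K by blast
  have "Fin z \<notin> kernel_julia_set G" using ker by simp
  then obtain g where g: "g \<in> G" "g (Fin z) \<in> fatou_set G"
    by (auto simp: kernel_julia_set_def julia_set_def)
  then obtain V where V: "open V" "g (Fin z) \<in> V" "equicontinuous_on V G"
    by (auto simp: fatou_set_def)
  obtain w where w: "g (Fin z) = Fin w"
    using z g(1) by (cases "g (Fin z)") (auto simp: K_iff)
  \<comment> \<open>Nearby orbits may leave the disc of radius \<open>R\<close>, but with this gap
    not the disc of radius \<open>R + 1\<close>; boundedness is all that membership in
    \<open>K\<close> asks.\<close>
  define e where "e = dist (Fin (of_real R)) Infty - dist (Fin (of_real (R + 1))) Infty"
  have "e > 0"
    using R_ge_1 dist_Fin_Infty_strict_antimono[of "of_real R" "of_real (R + 1)"]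
    by (simp add: e_def del: of_real_add)
  then obtain d where d: "d > 0"
    "\<And>y h. y \<in> V \<Longrightarrow> dist (Fin w) y < d \<Longrightarrow> h \<in> G \<Longrightarrow> dist (h (Fin w)) (h y) < e"
    using V(2,3) unfolding equicontinuous_on_def w by blast
  define U where "U = Fin -` (V \<inter> ball (Fin w) d)"
  have "U \<subseteq> K"
  proof
    fix y assume y: "y \<in> U"
    have "h (Fin y) \<in> Fin ` ball 0 (R + 1)" if h: "h \<in> G" for h
    proof -
      have "(h \<circ> g) (Fin z) \<notin> sphere_outside R"
        using z G_compose[OF h g(1)] unfolding K_iff by blast
      then have "dist (h (Fin w)) Infty \<ge> dist (Fin (of_real R)) Infty"
        using R_ge_1 by (simp add: w sphere_outside_eq_ball dist_commute not_less)
      moreover have "dist (h (Fin w)) (h (Fin y)) < e"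
        using y by (intro d(2) h) (auto simp: U_def)
      ultimately have less: "dist (Fin (of_real (R + 1))) Infty < dist (h (Fin y)) Infty"
        using dist_triangle[of "h (Fin w)" Infty "h (Fin y)"] by (simp add: e_def)
      show ?thesis
      proof (cases "h (Fin y)")
        case (Fin v)
        then have "norm v < R + 1"
          using less R_ge_1 by (simp add: dist_Fin_Infty_less_iff del: of_real_add)
        then show ?thesis using Fin by simp
      next
        case Infty
        then show ?thesis using less by (metis dist_self not_less zero_le_dist)
      qed
    qed
    then show "y \<in> K"
      unfolding smallest_filled_julia_set_def by (auto intro!: exI[of _ "ball 0 (R + 1)"])
  qed
  moreover have "open U" unfolding U_def by (intro open_vimage_Fin open_Int V(1) open_ball)
  moreover have "w \<in> U" using V(2) d(1) w by (simp add: U_def)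
  ultimately show ?thesis using interior_maximal by blast
qed

section \<open>Level sets of the escape probability\<close>

text \<open>The Fatou part \<open>W\<close> of the level of \<open>u\<close> is open by local
  constancy. A frontier point of \<open>W\<close> in \<open>U\<close> would be on the same level by
  continuity, hence a Fatou point by \<open>disj\<close>, hence interior to \<open>W\<close>. So
  \<open>U\<close> cannot cross the frontier.\<close>

lemma T_constant_on_connected:
  assumes cont: "continuous_on UNIV T" and U: "connected U" "u \<in> U" "u \<in> fatou_set G"
    and disj: "\<And>x. x \<in> U \<Longrightarrow> x \<in> julia_set G \<Longrightarrow> T x \<noteq> T u" and x: "x \<in> U"
  shows "T x = T u"
proof (rule ccontr)
  define W where "W = {y \<in> fatou_set G. T y = T u}"
  assume "T x \<noteq> T u"
  then have "U - W \<noteq> {}" "U \<inter> W \<noteq> {}" using x U by (auto simp: W_def)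
  then obtain y where y: "y \<in> U" "y \<in> frontier W" using connected_Int_frontier[OF U(1)] by blast
  have "closed (T -` {T u})" by (intro closed_vimage cont) auto
  then have "closure W \<subseteq> T -` {T u}" by (intro closure_minimal) (auto simp: W_def)
  then have Ty: "T y = T u" using y(2) by (auto simp: frontier_def)
  then have "y \<in> fatou_set G" using disj[OF y(1)] by (auto simp: julia_set_def)
  then obtain V where V: "open V" "y \<in> V" "\<And>v. v \<in> V \<Longrightarrow> T v = T y"
    using T_locally_constant by blast
  have "V \<inter> fatou_set G \<subseteq> W" using V(3) Ty by (auto simp: W_def)
  then have "y \<in> interior W"
    using V(1,2) \<open>y \<in> fatou_set G\<close> open_fatou_set by (intro interiorI[of "V \<inter> fatou_set G"]) auto
  then show False using y(2) by (simp add: frontier_def)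
qed

lemma T_constant_on_closure_in_fatou_set:
  assumes cont: "continuous_on UNIV T" and U: "connected U" "U \<subseteq> fatou_set G" "u \<in> U"
    and x: "x \<in> closure U"
  shows "T x = T u"
proof -
  have "T y = T u" if "y \<in> U" for y
    by (rule T_constant_on_connected[OF cont U(1,3)]) (use U that in \<open>auto simp: julia_set_def\<close>)
  moreover have "closed (T -` {T u})" by (intro closed_vimage cont) auto
  ultimately have "closure U \<subseteq> T -` {T u}" by (intro closure_minimal) auto
  then show ?thesis using x by auto
qed

text \<open>A level in the range that avoided the Julia set would be the whole sphere, by
  \<open>T_constant_on_connected\<close>; but \<open>T\<close> is 0 on \<open>K\<close> and 1 at
  infinity.\<close>

lemma T_julia_level:
  assumes cont: "continuous_on UNIV T" and K: "K \<noteq> {}" and t: "t \<in> {0..1}"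
  obtains x where "x \<in> julia_set G" "T x = t"
proof -
  obtain z where z: "T (Fin z) = 0" using K T_eq_0_if_in_K by blast
  have inf: "T Infty = 1" by (rule T_outside) simp
  have "connected (range T)" by (rule connected_continuous_image[OF cont connected_UNIV_sphere])
  then have "{0..1} \<subseteq> range T" using z inf connected_contains_Icc by (metis rangeI)
  then obtain u where u: "T u = t" using t by auto
  have "\<exists>x\<in>julia_set G. T x = T u"
  proof (rule ccontr)
    assume none: "\<not> ?thesis"
    then have "u \<in> fatou_set G" by (auto simp: julia_set_def)
    then have "T x = T u" for x
      using T_constant_on_connected[OF cont connected_UNIV_sphere UNIV_I, of u x] none by auto
    then show False using z inf by (metis zero_neq_one)
  qed
  then show thesis using u that by blast
qed

lemma compact_level: "continuous_on UNIV T \<Longrightarrow> compact (T -` {t})"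
  and compact_julia_level: "continuous_on UNIV T \<Longrightarrow> compact (T -` {t} \<inter> julia_set G)"
  using open_fatou_set[of G]
  by (auto simp: compact_sphere_iff julia_set_def closed_def[of "- fatou_set G"]
      intro!: closed_vimage closed_Int)

lemma levels_surrounded:
  assumes cont: "continuous_on UNIV T" and K: "K \<noteq> {}" and t: "0 \<le> t1" "t1 < t2" "t2 \<le> 1"
  shows "T -` {t1} <\<^sub>s T -` {t2} \<inter> julia_set G"
  unfolding surrounded_by_def
proof (intro conjI compact_level compact_julia_level cont)
  show "T -` {t1} \<noteq> {}" "T -` {t2} \<inter> julia_set G \<noteq> {}"
    using T_julia_level[OF cont K, of t1] T_julia_level[OF cont K, of t2] t by auto
  let ?L = "UNIV - Fin -` (T -` {t2} \<inter> julia_set G)"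
  show "T -` {t1} \<subseteq> Fin ` \<Union>{U \<in> components ?L. bounded U}"
  proof
    fix x assume x: "x \<in> T -` {t1}"
    have "T Infty = 1" by (rule T_outside) simp
    then obtain z where z: "x = Fin z" using x t by (cases x) auto
    define C where "C = connected_component_set ?L z"
    have zL: "z \<in> ?L" using x z t by auto
    then have C: "C \<in> components ?L" "z \<in> C" "connected C" "C \<subseteq> ?L"
      by (auto simp: C_def componentsI connected_component_subset)
    have "bounded C"
    proof (rule ccontr)
      assume "\<not> bounded C"
      then obtain w where w: "w \<in> C" "norm w > R" unfolding bounded_iff by (meson not_le)
      then have "T (Fin w) = 1" by (intro T_outside) simp
      have conn: "connected (Fin ` C)"
        by (intro connected_continuous_image continuous_on_Fin continuous_on_id C(3))
      then have "connected (T ` Fin ` C)"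
        by (rule connected_continuous_image[OF continuous_on_subset[OF cont subset_UNIV]])
      \<comment> \<open>An unbounded \<open>C\<close> reaches the region where \<open>T\<close> is
        1, so \<open>T\<close> passes through \<open>t2\<close> on it. Since \<open>C\<close> avoids
        Julia points of level \<open>t2\<close>, this happens at a Fatou point, which forces
        \<open>T\<close> to be constantly \<open>t2\<close> on \<open>C\<close>.\<close>
      moreover have "t1 \<in> T ` Fin ` C" "1 \<in> T ` Fin ` C"
        using C(2) w(1) x z \<open>T (Fin w) = 1\<close> by (force simp: image_iff)+
      ultimately have "{t1..1} \<subseteq> T ` Fin ` C" by (rule connected_contains_Icc)
      moreover have "t2 \<in> {t1..1}" using t by simp
      ultimately obtain u where u: "u \<in> C" "T (Fin u) = t2" by blast
      then have "Fin u \<in> fatou_set G" using C(4) by (auto simp: julia_set_def)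
      have "T (Fin z) = T (Fin u)"
        by (rule T_constant_on_connected[OF cont conn _ \<open>Fin u \<in> fatou_set G\<close>]) (use u C in auto)
      then show False using u x z t by simp
    qed
    then show "x \<in> Fin ` \<Union>{U \<in> components ?L. bounded U}" using C z by blast
  qed
qed

text \<open>\<open>T\<close> equals 1 on the closure of the component at infinity, so lower levels
  miss it. That component contains a disc about infinity, so every component of the complement is
  bounded.\<close>

lemma level_surrounded_by_fatou_infinity:
  assumes cont: "continuous_on UNIV T" and K: "K \<noteq> {}" and t: "0 \<le> t" "t < 1"
  shows "T -` {t} \<inter> julia_set G <\<^sub>s closure (fatou_infinity G)"
  unfolding surrounded_by_def
proof (intro conjI compact_julia_level cont)
  define V where "V = fatou_infinity G"
  have V: "connected V" "V \<subseteq> fatou_set G" "Infty \<in> V"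
    using Infty_in_fatou_set by (auto simp: V_def fatou_infinity_def connected_component_subset)
  have T_V: "T x = 1" if "x \<in> closure V" for x
    using T_constant_on_closure_in_fatou_set[OF cont V that] T_outside[of Infty] by simp
  show "T -` {t} \<inter> julia_set G \<noteq> {}"
    using T_julia_level[OF cont K, of t] t by auto
  show "closure (fatou_infinity G) \<noteq> {}" using V(3) by (auto simp: V_def)
  show "compact (closure (fatou_infinity G))" by (simp add: compact_sphere_iff)
  let ?L = "UNIV - Fin -` closure (fatou_infinity G)"
  obtain r where r: "r > 0" "sphere_outside r \<subseteq> fatou_set G"
    using open_Infty_contains_sphere_outside[OF open_fatou_set Infty_in_fatou_set] by blast
  have "sphere_outside r \<subseteq> V"
    unfolding V_def fatou_infinity_def
    by (rule connected_component_maximal[OF _ connected_sphere_outside r(2)]) simp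
  have out: "norm w \<le> r" if "w \<in> ?L" for w
  proof (rule ccontr)
    assume "\<not> norm w \<le> r"
    then have "Fin w \<in> sphere_outside r" by simp
    then have "Fin w \<in> closure V" using \<open>sphere_outside r \<subseteq> V\<close> closure_subset[of V] by blast
    then show False using that by (simp add: V_def)
  qed
  show "T -` {t} \<inter> julia_set G \<subseteq> Fin ` \<Union>{U \<in> components ?L. bounded U}"
  proof
    fix x assume "x \<in> T -` {t} \<inter> julia_set G"
    then have "x \<notin> closure V" using T_V t by auto
    moreover have "Infty \<in> closure V" using V(3) closure_subset by blast
    ultimately obtain z where z: "x = Fin z" "z \<in> ?L" by (cases x) (auto simp: V_def)
    then have "z \<in> connected_component_set ?L z" "connected_component_set ?L z \<in> components ?L"
      by (auto simp: componentsI)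
    moreover have "bounded (connected_component_set ?L z)"
      using out connected_component_subset[of ?L z] unfolding bounded_iff by blast
    ultimately show "x \<in> Fin ` \<Union>{U \<in> components ?L. bounded U}" using z(1) by blast
  qed
qed

text \<open>Every value on the Fatou set is taken on an open set, hence at a point of a fixed
  countable dense set.\<close>

lemma countable_T_fatou_set: "countable (T ` fatou_set G)"
proof -
  obtain D :: "riemann_sphere set" where D: "countable D" "\<And>X. open X \<Longrightarrow> X \<noteq> {} \<Longrightarrow> \<exists>d\<in>D. d \<in> X"
    using countable_dense_setE by blast
  have "T ` fatou_set G \<subseteq> T ` D"
  proof clarify
    fix z assume "z \<in> fatou_set G"
    then obtain U where "open U" "z \<in> U" "\<And>y. y \<in> U \<Longrightarrow> T y = T z"
      using T_locally_constant by blast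
    then show "T z \<in> T ` D" using D(2)[of U] by (metis emptyE imageI)
  qed
  then show ?thesis using D(1) by (meson countable_image countable_subset)
qed

text \<open>A Julia point on the boundary of a Fatou component has the value of \<open>T\<close> on
  that component. Removing the countably many values on the Fatou set leaves only levels whose Julia
  points touch no component.\<close>

lemma residual_julia_levels:
  assumes cont: "continuous_on UNIV T" and K: "K \<noteq> {}"
  shows "\<exists>A. A \<subseteq> {0..1} \<and> uncountable A \<and> {0..1} \<subseteq> closure A \<and> countable ({0..1} - A)
     \<and> (\<forall>t\<in>A. T -` {t} \<inter> julia_set G \<noteq> {} \<and> T -` {t} \<inter> julia_set G \<subseteq> residual_julia_set G)"
proof (intro exI[of _ "{0..1} - T ` fatou_set G"] conjI ballI)
  let ?F = "T ` fatou_set G" let ?A = "{0..1} - ?F"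
  show "?A \<subseteq> {0..1}" by blast
  show "countable ({0..1} - ?A)"
    by (rule countable_subset[OF _ countable_T_fatou_set]) auto
  have unc: "\<exists>y\<in>{a<..<b} - ?F. True" if "a < b" for a b
    using uncountable_open_interval[of a b] that countable_subset[OF _ countable_T_fatou_set] by blast
  show "uncountable ?A"
    using uncountable_minus_countable[OF _ countable_T_fatou_set] uncountable_closed_interval[of 0 1] by auto
  show "{0..1} \<subseteq> closure ?A"
  proof
    fix x :: real assume x: "x \<in> {0..1}"
    show "x \<in> closure ?A"
      unfolding closure_approachable
    proof (intro allI impI)
      fix e :: real assume "e > 0"
      \<comment> \<open>Trimming to the unit interval keeps the approximating point inside
        \<open>[0,1]\<close>; the trimmed interval is nondegenerate because \<open>x\<close> lies in
        \<open>[0,1]\<close>.\<close>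
      then have "max 0 (x - e) < min 1 (x + e)" using x by auto
      from unc[OF this] obtain y where "y \<in> {max 0 (x - e)<..<min 1 (x + e)} - ?F" by blast
      then show "\<exists>y\<in>?A. dist y x < e" by (intro bexI[of _ y]) (auto simp: dist_real_def)
    qed
  qed
  fix t assume t: "t \<in> ?A"
  show "T -` {t} \<inter> julia_set G \<noteq> {}" using T_julia_level[OF cont K, of t] t by auto
  show "T -` {t} \<inter> julia_set G \<subseteq> residual_julia_set G"
  proof
    fix z assume z: "z \<in> T -` {t} \<inter> julia_set G"
    have "z \<notin> frontier U" if U: "U \<in> components (fatou_set G)" for U
    proof
      assume "z \<in> frontier U"
      then have "z \<in> closure U" by (simp add: frontier_def)
      moreover obtain u where "u \<in> U" using in_components_nonempty[OF U] by blast
      ultimately have "T z = T u"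
        using T_constant_on_closure_in_fatou_set[OF cont in_components_connected[OF U]
            in_components_subset[OF U]] by blast
      moreover have "T u \<in> T ` fatou_set G" using in_components_subset[OF U] \<open>u \<in> U\<close> by blast
      ultimately show False using z t by auto
    qed
    then show "z \<in> residual_julia_set G" using z by (simp add: residual_julia_set_def)
  qed
qed

end

theorem theorem3p31:
  fixes \<tau> :: "polynomial_map measure"
  assumes "\<tau> \<in> compactly_supported_prob_measures"
    and "kernel_julia_set (semigroup_of \<tau>) = {}"
    and "smallest_filled_julia_set (semigroup_of \<tau>) \<noteq> {}"
  shows "interior (smallest_filled_julia_set (semigroup_of \<tau>)) \<noteq> {}
    \<and> prob_escape \<tau> ` julia_set (semigroup_of \<tau>) = {0..1}
    \<and> (\<forall>t1 t2. 0 \<le> t1 \<and> t1 < t2 \<and> t2 \<le> 1 \<longrightarrow>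
         prob_escape \<tau> -` {t1} <\<^sub>s prob_escape \<tau> -` {t2} \<inter> julia_set (semigroup_of \<tau>))
    \<and> (\<forall>t\<in>{0<..<1}.
         Fin ` smallest_filled_julia_set (semigroup_of \<tau>)
           <\<^sub>s prob_escape \<tau> -` {t} \<inter> julia_set (semigroup_of \<tau>)
         \<and> prob_escape \<tau> -` {t} \<inter> julia_set (semigroup_of \<tau>)
           <\<^sub>s closure (fatou_infinity (semigroup_of \<tau>)))
    \<and> (\<exists>A. A \<subseteq> {0..1} \<and> uncountable A \<and> {0..1} \<subseteq> closure A \<and> countable ({0..1} - A)
         \<and> (\<forall>t\<in>A. prob_escape \<tau> -` {t} \<inter> julia_set (semigroup_of \<tau>) \<noteq> {}
             \<and> prob_escape \<tau> -` {t} \<inter> julia_set (semigroup_of \<tau>)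
                \<subseteq> residual_julia_set (semigroup_of \<tau>)))"
proof -
  interpret random_polynomials \<tau> by standard (rule assms(1))
  have cont: "continuous_on UNIV T" by (rule continuous_on_T[OF assms(2)])
  note K = assms(3)
  have "T ` julia_set G = {0..1}"
  proof
    show "T ` julia_set G \<subseteq> {0..1}" using T_bounds by auto
    show "{0..1} \<subseteq> T ` julia_set G" using T_julia_level[OF cont K] by blast
  qed
  moreover have "Fin ` K <\<^sub>s T -` {t} \<inter> julia_set G" if t: "t \<in> {0<..<1}" for t
  proof -
    \<comment> \<open>Being surrounded passes from level 0 to its subset, but compactness does not
      and is supplied by \<open>compact_K\<close>.\<close>
    have "Fin ` K \<subseteq> T -` {0}" using T_eq_0_if_in_K by auto
    moreover have "compact (Fin ` K)"
      by (intro compact_continuous_image continuous_on_Fin continuous_on_id compact_K)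
    ultimately show ?thesis
      using levels_surrounded[OF cont K, of 0 t] t K unfolding surrounded_by_def by auto
  qed
  ultimately show ?thesis
    using levels_surrounded[OF cont K] level_surrounded_by_fatou_infinity[OF cont K]
    by (intro conjI interior_K[OF assms(2) K] residual_julia_levels[OF cont K]) simp_all
qed

end
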